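(* Let $(\mathbb{S}^6,J,g)$ be the six-dimensional sphere with its usual nearly Kähler structure (induced by the octonionic product), let $\omega(X,Y)=g(JX,Y)$, and let $\nabla^{LC}$ be the Levi-Civita connection of $g$. Then there are no functions $a,b,c\in C^\infty(\mathbb{S}^6)$ with $a^2+b^2+c^2=1$, with $b$ not identically equal to $1$ and not identically equal to $-1$, such that the weak generalized almost complex structure $\mathsf{J}=a\,\mathsf{J}_{1,J}+b\,\mathsf{J}_g+c\,\mathfrak{J}_\omega$ is $[\cdot,\cdot]_{\nabla^{LC}}$-integrable.
   Context: For a smooth manifold $M$ let $E=TM\oplus T^*M$; $C^\infty(E)$ denotes smooth sections, written $X+\xi$. A weak generalized almost complex structure is a smooth bundle endomorphism $\mathsf{J}:E\to E$ with $\mathsf{J}^2=-\mathrm{Id}$. For an affine connection $\nabla$ on $TM$ (extended to $T^*M$ by duality) set $[X+\xi,Y+\eta]_\nabla=[X,Y]+\nabla_X\eta-\nabla_Y\xi$. $\mathsf{J}$ is $[\cdot,\cdot]_\nabla$-integrable if $N(v,w)=[\mathsf{J}v,\mathsf{J}w]_\nabla-\mathsf{J}[\mathsf{J}v,w]_\nabla-\mathsf{J}[v,\mathsf{J}w]_\nabla-[v,w]_\nabla$ vanishes for all $v,w\in C^\infty(E)$. Structure on $\mathbb{S}^6$: identify $\mathbb{R}^7$ with the imaginary octonions and let $\times$ be the induced (cross) product. On the unit sphere $\mathbb{S}^6\subset\mathbb{R}^7$, $g$ is the induced round metric and $J_p(v)=p\times v$ for $v\in T_p\mathbb{S}^6$.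 Then $J^2=-\mathrm{Id}$ and $g(JX,JY)=g(X,Y)$. Regard $g$ and $\omega$ as maps $TM\to T^*M$, $X\mapsto g(X,\cdot)$, $X\mapsto\omega(X,\cdot)$, and let $J^*\xi=\xi\circ J$. In block form with respect to $TM\oplus T^*M$: $$\mathsf{J}_{1,J}=\begin{pmatrix} J & 0 \\ 0 & J^* \end{pmatrix},\quad \mathsf{J}_g=\begin{pmatrix} 0 & -g^{-1} \\ g & 0 \end{pmatrix},\quad \mathfrak{J}_\omega=\begin{pmatrix} 0 & -\omega^{-1} \\ \omega & 0 \end{pmatrix}.$$ Any combination $a\mathsf{J}_{1,J}+b\mathsf{J}_g+c\mathfrak{J}_\omega$ with smooth coefficients satisfying $a^2+b^2+c^2=1$ is a weak generalized almost complex structure (called a spherical combination). *)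

theory Defs
  imports "HOL-Analysis.Analysis"
begin

section \<open>Octonions and the cross product on \<open>\<real>\<^sup>7\<close>\<close>

text \<open>
  The octonions are \<open>\<real> \<oplus> Im(\<O>)\<close> with \<open>Im(\<O>) = \<real>\<^sup>7\<close>; the imaginary units \<open>e i\<close> are
  indexed by the type \<open>7\<close>, whose arithmetic is modulo 7.  The multiplication table is
  \<open>e i * e i = -1\<close> and \<open>e i * e (i+1) = e (i+3) = - e (i+1) * e i\<close>, together with the cyclic
  permutations of each triple \<open>(e i, e (i+1), e (i+3))\<close>.
\<close>

type_synonym R7 = "real ^ 7"

definition oct_mult :: "real \<times> R7 \<Rightarrow> real \<times> R7 \<Rightarrow> real \<times> R7" where
  "oct_mult = (\<lambda>(a, x) (b, y).
     (a * b - x \<bullet> y,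
      a *\<^sub>R y + b *\<^sub>R x +
      (\<chi> i. x $ (i+1) * y $ (i+3) - x $ (i+3) * y $ (i+1)
          + x $ (i+2) * y $ (i+6) - x $ (i+6) * y $ (i+2)
          + x $ (i+4) * y $ (i+5) - x $ (i+5) * y $ (i+4))))"

definition cross7 :: "R7 \<Rightarrow> R7 \<Rightarrow> R7" where
  "cross7 x y = snd (oct_mult (0, x) (0, y))"

lemma UNIV_7: "(UNIV :: 7 set) = {0, 1, 2, 3, 4, 5, 6}"
proof -
  have "card {0, 1, 2, 3, 4, 5, 6 :: 7} = CARD(7)" by simp
  then show ?thesis by (metis card_subset_eq finite subset_UNIV)
qed

lemma sum_7: "sum f (UNIV :: 7 set) = f 0 + f 1 + f 2 + f 3 + f 4 + f 5 + f 6"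
  unfolding UNIV_7 by (simp add: ac_simps)

lemma forall_7: "(\<forall>i :: 7. P i) \<longleftrightarrow> P 0 \<and> P 1 \<and> P 2 \<and> P 3 \<and> P 4 \<and> P 5 \<and> P 6"
proof -
  have "(\<forall>i :: 7. P i) \<longleftrightarrow> (\<forall>i \<in> {0, 1, 2, 3, 4, 5, 6 :: 7}. P i)"
    by (simp flip: UNIV_7)
  then show ?thesis by simp
qed

lemma cross7_nth:
  "cross7 x y $ i = x $ (i+1) * y $ (i+3) - x $ (i+3) * y $ (i+1)
                  + x $ (i+2) * y $ (i+6) - x $ (i+6) * y $ (i+2)
                  + x $ (i+4) * y $ (i+5) - x $ (i+5) * y $ (i+4)"
  by (simp add: cross7_def oct_mult_def)

lemma numerals_7:
  "(7 :: 7) = 0" "(8 :: 7) = 1" "(9 :: 7) = 2" "(10 :: 7) = 3" "(11 :: 7) = 4" "(12 :: 7) = 5"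
  by simp_all

lemma cross7_coords:
  "cross7 x y $ 0 = x $ 1 * y $ 3 - x $ 3 * y $ 1 + x $ 2 * y $ 6 - x $ 6 * y $ 2 + x $ 4 * y $ 5 - x $ 5 * y $ 4"
  "cross7 x y $ 1 = x $ 2 * y $ 4 - x $ 4 * y $ 2 + x $ 3 * y $ 0 - x $ 0 * y $ 3 + x $ 5 * y $ 6 - x $ 6 * y $ 5"
  "cross7 x y $ 2 = x $ 3 * y $ 5 - x $ 5 * y $ 3 + x $ 4 * y $ 1 - x $ 1 * y $ 4 + x $ 6 * y $ 0 - x $ 0 * y $ 6"
  "cross7 x y $ 3 = x $ 4 * y $ 6 - x $ 6 * y $ 4 + x $ 5 * y $ 2 - x $ 2 * y $ 5 + x $ 0 * y $ 1 - x $ 1 * y $ 0"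
  "cross7 x y $ 4 = x $ 5 * y $ 0 - x $ 0 * y $ 5 + x $ 6 * y $ 3 - x $ 3 * y $ 6 + x $ 1 * y $ 2 - x $ 2 * y $ 1"
  "cross7 x y $ 5 = x $ 6 * y $ 1 - x $ 1 * y $ 6 + x $ 0 * y $ 4 - x $ 4 * y $ 0 + x $ 2 * y $ 3 - x $ 3 * y $ 2"
  "cross7 x y $ 6 = x $ 0 * y $ 2 - x $ 2 * y $ 0 + x $ 1 * y $ 5 - x $ 5 * y $ 1 + x $ 3 * y $ 4 - x $ 4 * y $ 3"
  by (simp_all add: cross7_nth numerals_7)

lemma cross7_table:
  "cross7 (axis i 1) (axis (i+1) 1) = axis (i+3) 1"
proof -
  have "\<forall>i. \<forall>j. cross7 (axis i 1) (axis (i+1) 1) $ j = axis (i+3) 1 $ j"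
    by (simp add: forall_7 cross7_nth axis_def)
  then show ?thesis by (simp add: vec_eq_iff)
qed

lemma inner_cross7_left: "p \<bullet> cross7 p v = 0"
  by (simp add: inner_vec_def sum_7 cross7_coords algebra_simps)

lemma cross7_cross7: "cross7 p (cross7 p v) = (p \<bullet> v) *\<^sub>R p - (p \<bullet> p) *\<^sub>R v"
  by (simp add: vec_eq_iff forall_7 inner_vec_def sum_7 cross7_coords algebra_simps)

lemma oct_mult_norm:
  "norm (oct_mult p q) = norm p * norm q"
proof -
  obtain a x b y where pq: "p = (a, x)" "q = (b, y)" by (metis surj_pair)
  let ?c = "cross7 x y"
  have c: "x \<bullet> ?c = 0" "y \<bullet> ?c = 0"
    by (simp_all add: inner_vec_def sum_7 cross7_coords algebra_simps)
  have cc: "?c \<bullet> ?c = (x \<bullet> x) * (y \<bullet> y) - (x \<bullet> y)\<^sup>2"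
    by (simp add: inner_vec_def sum_7 cross7_coords power2_eq_square algebra_simps)
  have m: "oct_mult (a, x) (b, y) = (a * b - x \<bullet> y, a *\<^sub>R y + b *\<^sub>R x + ?c)"
    by (simp add: oct_mult_def cross7_def)
  have "(oct_mult p q) \<bullet> (oct_mult p q) = (p \<bullet> p) * (q \<bullet> q)"
    unfolding pq m inner_Pair using c cc
    by (simp add: inner_add_left inner_add_right inner_commute power2_eq_square algebra_simps)
  then show ?thesis
    by (simp add: norm_eq_sqrt_inner real_sqrt_mult)
qed


section \<open>Calculus on the unit sphere\<close>

abbreviation S6 :: "R7 set" where
  "S6 \<equiv> sphere 0 1"

definition tangent :: "R7 \<Rightarrow> R7 set" where
  "tangent p = {v. p \<bullet> v = 0}"

text \<open>
  Functions, vector fields and 1-forms on \<open>S6\<close> are represented by total functions on \<open>\<real>\<^sup>7\<close>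
  of which only the values at points of \<open>S6\<close> matter; similarly only the values on \<open>tangent p\<close> of
  a covector at \<open>p\<close> matter.  All statements below compare such objects only there.
\<close>

fun Ck_on :: "nat \<Rightarrow> ('a::real_normed_vector \<Rightarrow> 'b::real_normed_vector) \<Rightarrow> 'a set \<Rightarrow> bool" where
  "Ck_on 0 f U \<longleftrightarrow> continuous_on U f"
| "Ck_on (Suc k) f U \<longleftrightarrow> (\<forall>x\<in>U. f differentiable at x) \<and>
     (\<forall>v. Ck_on k (\<lambda>x. frechet_derivative f (at x) v) U)"

definition smooth_map :: "(R7 \<Rightarrow> 'b::real_normed_vector) \<Rightarrow> bool" where
  "smooth_map f \<longleftrightarrow> (\<forall>p\<in>S6. \<exists>U F. open U \<and> p \<in> U \<and> (\<forall>k. Ck_on k F U) \<and>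
     (\<forall>x\<in>U \<inter> S6. F x = f x))"

abbreviation smooth_fun :: "(R7 \<Rightarrow> real) \<Rightarrow> bool" where
  "smooth_fun \<equiv> smooth_map"

definition smooth_vf :: "(R7 \<Rightarrow> R7) \<Rightarrow> bool" where
  "smooth_vf X \<longleftrightarrow> smooth_map X \<and> (\<forall>p\<in>S6. X p \<in> tangent p)"

definition smooth_form :: "(R7 \<Rightarrow> R7 \<Rightarrow> real) \<Rightarrow> bool" where
  "smooth_form \<xi> \<longleftrightarrow>
     (\<forall>p\<in>S6. \<forall>u\<in>tangent p. \<forall>v\<in>tangent p. \<forall>s t. \<xi> p (s *\<^sub>R u + t *\<^sub>R v) = s * \<xi> p u + t * \<xi> p v) \<and>
     (\<forall>X. smooth_vf X \<longrightarrow> smooth_fun (\<lambda>p. \<xi> p (X p)))"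

text \<open>
  The derivative of \<open>f\<close> at \<open>p\<close> in the direction of a tangent vector \<open>v\<close>: for \<open>p \<in> S6\<close> and
  \<open>v \<in> tangent p\<close> the curve \<open>t \<mapsto> sgn (p + t v) = (p + t v) / norm (p + t v)\<close> lies in \<open>S6\<close>, passes
  through \<open>p\<close> at \<open>t = 0\<close> and has velocity \<open>v\<close> there.
\<close>

definition dderiv :: "(R7 \<Rightarrow> real) \<Rightarrow> R7 \<Rightarrow> R7 \<Rightarrow> real" where
  "dderiv f p v = vector_derivative (\<lambda>t. f (sgn (p + t *\<^sub>R v))) (at 0)"

definition vf_apply :: "(R7 \<Rightarrow> R7) \<Rightarrow> (R7 \<Rightarrow> real) \<Rightarrow> R7 \<Rightarrow> real" where
  "vf_apply X f p = dderiv f p (X p)"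

definition lie_bracket ::
    "(R7 \<Rightarrow> R7) \<Rightarrow> (R7 \<Rightarrow> R7) \<Rightarrow> R7 \<Rightarrow> R7" where
  "lie_bracket X Y p = (THE v. v \<in> tangent p \<and>
     (\<forall>f. smooth_fun f \<longrightarrow>
        dderiv f p v = vf_apply X (vf_apply Y f) p - vf_apply Y (vf_apply X f) p))"


section \<open>The nearly Kaehler structure and the Levi-Civita connection\<close>

definition round_g :: "R7 \<Rightarrow> R7 \<Rightarrow> R7 \<Rightarrow> real" where
  "round_g p u v = u \<bullet> v"

definition J6 :: "R7 \<Rightarrow> R7 \<Rightarrow> R7" where
  "J6 p v = cross7 p v"

definition omega6 :: "R7 \<Rightarrow> R7 \<Rightarrow> R7 \<Rightarrow> real" where
  "omega6 p u v = round_g p (J6 p u) v"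

type_synonym connection7 =
  "(R7 \<Rightarrow> R7) \<Rightarrow> (R7 \<Rightarrow> R7) \<Rightarrow> R7 \<Rightarrow> R7"

definition affine_connection :: "connection7 \<Rightarrow> bool" where
  "affine_connection D \<longleftrightarrow>
     (\<forall>X Y. smooth_vf X \<longrightarrow> smooth_vf Y \<longrightarrow> smooth_vf (D X Y)) \<and>
     (\<forall>X Y Z. smooth_vf X \<longrightarrow> smooth_vf Y \<longrightarrow> smooth_vf Z \<longrightarrow>
        (\<forall>p\<in>S6. D (\<lambda>q. X q + Y q) Z p = D X Z p + D Y Z p)) \<and>
     (\<forall>f X Y. smooth_fun f \<longrightarrow> smooth_vf X \<longrightarrow> smooth_vf Y \<longrightarrow>
        (\<forall>p\<in>S6. D (\<lambda>q. f q *\<^sub>R X q) Y p = f p *\<^sub>R D X Y p)) \<and>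
     (\<forall>X Y Z. smooth_vf X \<longrightarrow> smooth_vf Y \<longrightarrow> smooth_vf Z \<longrightarrow>
        (\<forall>p\<in>S6. D X (\<lambda>q. Y q + Z q) p = D X Y p + D X Z p)) \<and>
     (\<forall>f X Y. smooth_fun f \<longrightarrow> smooth_vf X \<longrightarrow> smooth_vf Y \<longrightarrow>
        (\<forall>p\<in>S6. D X (\<lambda>q. f q *\<^sub>R Y q) p = vf_apply X f p *\<^sub>R Y p + f p *\<^sub>R D X Y p))"

definition torsion_free :: "connection7 \<Rightarrow> bool" where
  "torsion_free D \<longleftrightarrow> (\<forall>X Y. smooth_vf X \<longrightarrow> smooth_vf Y \<longrightarrow>
     (\<forall>p\<in>S6. D X Y p - D Y X p = lie_bracket X Y p))"

definition metric_connection :: "connection7 \<Rightarrow> bool" where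
  "metric_connection D \<longleftrightarrow> (\<forall>X Y Z. smooth_vf X \<longrightarrow> smooth_vf Y \<longrightarrow> smooth_vf Z \<longrightarrow>
     (\<forall>p\<in>S6. vf_apply X (\<lambda>q. round_g q (Y q) (Z q)) p
        = round_g p (D X Y p) (Z p) + round_g p (Y p) (D X Z p)))"

definition levi_civita :: "connection7 \<Rightarrow> bool" where
  "levi_civita D \<longleftrightarrow> affine_connection D \<and> torsion_free D \<and> metric_connection D"

text \<open>
  The dual connection on 1-forms, \<open>(D\<^sub>X \<xi>)(U) = X(\<xi>(U)) - \<xi>(D\<^sub>X U)\<close>.  The right-hand side at \<open>p\<close>
  depends on \<open>U\<close> only through \<open>U p\<close>, so that it defines a covector at \<open>p\<close>.
\<close>

definition dual_conn ::
    "connection7 \<Rightarrow> (R7 \<Rightarrow> R7) \<Rightarrow> (R7 \<Rightarrow> R7 \<Rightarrow> real) \<Rightarrow>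
     R7 \<Rightarrow> R7 \<Rightarrow> real" where
  "dual_conn D X \<xi> p u = (THE r. \<forall>U. smooth_vf U \<and> U p = u \<longrightarrow>
     r = vf_apply X (\<lambda>q. \<xi> q (U q)) p - \<xi> p (D X U p))"


section \<open>The generalized tangent bundle\<close>

text \<open>
  An element of the fibre of \<open>E = T \<oplus> T\<^sup>*\<close> at \<open>p\<close> is a pair of a tangent vector and a covector;
  \<open>eq_at p\<close> is equality in that fibre.
\<close>

type_synonym gvec = "R7 \<times> (R7 \<Rightarrow> real)"

definition gadd :: "gvec \<Rightarrow> gvec \<Rightarrow> gvec" (infixl "\<oplus>\<^sub>E" 65) where
  "e \<oplus>\<^sub>E e' = (fst e + fst e', \<lambda>u. snd e u + snd e' u)"

definition gdiff :: "gvec \<Rightarrow> gvec \<Rightarrow> gvec" (infixl "\<ominus>\<^sub>E" 65) where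
  "e \<ominus>\<^sub>E e' = (fst e - fst e', \<lambda>u. snd e u - snd e' u)"

definition gscale :: "real \<Rightarrow> gvec \<Rightarrow> gvec" (infixr "\<odot>\<^sub>E" 75) where
  "s \<odot>\<^sub>E e = (s *\<^sub>R fst e, \<lambda>u. s * snd e u)"

definition gzero :: gvec where
  "gzero = (0, \<lambda>u. 0)"

definition eq_at :: "R7 \<Rightarrow> gvec \<Rightarrow> gvec \<Rightarrow> bool" where
  "eq_at p e e' \<longleftrightarrow> fst e = fst e' \<and> (\<forall>u\<in>tangent p. snd e u = snd e' u)"

definition smooth_section :: "(R7 \<Rightarrow> gvec) \<Rightarrow> bool" where
  "smooth_section v \<longleftrightarrow> smooth_vf (\<lambda>p. fst (v p)) \<and> smooth_form (\<lambda>p. snd (v p))"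

text \<open>
  The inverse at \<open>p\<close> of the map \<open>T\<^sub>p \<rightarrow> T\<^sub>p\<^sup>*\<close>, \<open>X \<mapsto> B(X, \<cdot>)\<close>, given by a nondegenerate bilinear
  form \<open>B\<close>.
\<close>

definition form_inv ::
    "(R7 \<Rightarrow> R7 \<Rightarrow> R7 \<Rightarrow> real) \<Rightarrow> R7 \<Rightarrow> (R7 \<Rightarrow> real) \<Rightarrow> R7" where
  "form_inv B p \<alpha> = (THE v. v \<in> tangent p \<and> (\<forall>u\<in>tangent p. B p v u = \<alpha> u))"

definition gJ_J :: "R7 \<Rightarrow> gvec \<Rightarrow> gvec" where
  "gJ_J p e = (J6 p (fst e), \<lambda>u. snd e (J6 p u))"

definition gJ_form ::
    "(R7 \<Rightarrow> R7 \<Rightarrow> R7 \<Rightarrow> real) \<Rightarrow> R7 \<Rightarrow> gvec \<Rightarrow> gvec" where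
  "gJ_form B p e = (- form_inv B p (snd e), \<lambda>u. B p (fst e) u)"

definition spherical ::
    "(R7 \<Rightarrow> real) \<Rightarrow> (R7 \<Rightarrow> real) \<Rightarrow> (R7 \<Rightarrow> real) \<Rightarrow> R7 \<Rightarrow> gvec \<Rightarrow> gvec" where
  "spherical a b c p e =
     a p \<odot>\<^sub>E gJ_J p e \<oplus>\<^sub>E b p \<odot>\<^sub>E gJ_form round_g p e \<oplus>\<^sub>E c p \<odot>\<^sub>E gJ_form omega6 p e"

definition conn_bracket ::
    "connection7 \<Rightarrow> (R7 \<Rightarrow> gvec) \<Rightarrow> (R7 \<Rightarrow> gvec) \<Rightarrow> R7 \<Rightarrow> gvec" where
  "conn_bracket D v w =
     (let X = (\<lambda>q. fst (v q)); \<xi> = (\<lambda>q. snd (v q)); Y = (\<lambda>q. fst (w q)); \<eta> = (\<lambda>q. snd (w q))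
      in (\<lambda>p. (lie_bracket X Y p, \<lambda>u. dual_conn D X \<eta> p u - dual_conn D Y \<xi> p u)))"

definition nijenhuis ::
    "connection7 \<Rightarrow> (R7 \<Rightarrow> gvec \<Rightarrow> gvec) \<Rightarrow> (R7 \<Rightarrow> gvec) \<Rightarrow> (R7 \<Rightarrow> gvec) \<Rightarrow>
     R7 \<Rightarrow> gvec" where
  "nijenhuis D \<J> v w p =
     (let Jv = (\<lambda>q. \<J> q (v q)); Jw = (\<lambda>q. \<J> q (w q))
      in conn_bracket D Jv Jw p \<ominus>\<^sub>E \<J> p (conn_bracket D Jv w p)
         \<ominus>\<^sub>E \<J> p (conn_bracket D v Jw p) \<ominus>\<^sub>E conn_bracket D v w p)"

definition conn_integrable :: "connection7 \<Rightarrow> (R7 \<Rightarrow> gvec \<Rightarrow> gvec) \<Rightarrow> bool" where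
  "conn_integrable D \<J> \<longleftrightarrow> (\<forall>v w. smooth_section v \<longrightarrow> smooth_section w \<longrightarrow>
     (\<forall>p\<in>S6. eq_at p (nijenhuis D \<J> v w p) gzero))"

end

theory Submission
  imports Defs
begin

text \<open>
  Identify \<open>T\<^sup>*\<close> with \<open>T\<close> through \<open>g\<close>.  Since the Levi-Civita connection is metric, it becomes
  \<open>\<nabla>\<close> on both summands, and \<open>\<J>(X, Z) = (aJX - bZ + cJZ, -aJZ + bX + cJX)\<close>.  Moreover
  \<open>(\<nabla>\<^sub>X J)Y\<close> is the tangential part of \<open>X \<times> Y\<close>.

  At a point \<open>p\<close> choose tangent vectors \<open>u, w \<noteq> 0\<close> with \<open>u\<close>, \<open>w\<close>, \<open>Ju\<close> orthogonal, put \<open>m = u \<times> w\<close>,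
  \<open>n = Jm\<close>, and extend \<open>u, w\<close> to fields \<open>U, W\<close> by orthogonal projection, so that
  \<open>\<nabla>U = \<nabla>W = 0\<close> at \<open>p\<close>.  All derivatives of \<open>a, b, c\<close> in the Nijenhuis tensor come with multiples
  of \<open>u, w, Ju, Jw\<close>, which are orthogonal to \<open>m\<close> and \<open>n\<close>; up to the factor \<open>|u|\<^sup>2|w|\<^sup>2\<close> one finds
  \<^item> \<open>\<langle>n, pr\<^sub>1 N((0,U),(0,W))\<rangle> = -2c\<^sup>2\<close>, hence \<open>c = 0\<close>;
  \<^item> \<open>\<langle>m, pr\<^sub>2 N((0,U),(0,W))\<rangle> = 2ab\<close> where \<open>c = 0\<close>, hence \<open>b \<in> {0, 1, -1}\<close>, so that \<open>b = 0\<close> everywhere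
    because the sphere is connected;
  \<^item> \<open>\<langle>n, pr\<^sub>1 N((U,0),(W,0))\<rangle> = -4a\<^sup>2\<close> if \<open>b = c = 0\<close>, contradicting \<open>a\<^sup>2 = 1\<close>.
\<close>

section \<open>Functions of class \<open>C\<^sup>k\<close>\<close>

text \<open>Equality on an open set forces equal derivatives at each of its points, so the induction
  passes to every directional derivative.\<close>

lemma Ck_on_cong:
  assumes "open U" "\<And>x. x \<in> U \<Longrightarrow> f x = g x" "Ck_on k f U"
  shows "Ck_on k g U"
  using assms(2,3)
proof (induction k arbitrary: f g)
  case 0
  then show ?case using continuous_on_cong[of U U f g] by simp
next
  case (Suc k)
  have ev: "eventually (\<lambda>y. f y = g y) (nhds x)" if "x \<in> U" for x
    using eventually_nhds_in_open[OF assms(1) that] Suc.prems(1) by (auto elim: eventually_mono)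
  have d: "(g has_derivative frechet_derivative f (at x)) (at x)" if "x \<in> U" for x
  proof -
    have "(f has_derivative frechet_derivative f (at x)) (at x)"
      using Suc.prems(2) that by (simp add: frechet_derivative_works[symmetric])
    then show ?thesis
      using has_derivative_transform_within_open[OF _ assms(1) that] Suc.prems(1) by blast
  qed
  have e: "frechet_derivative f (at x) v = frechet_derivative g (at x) v" if "x \<in> U" for x v
    using frechet_derivative_at[OF d[OF that]] by simp
  have "g differentiable at x" if "x \<in> U" for x
    using d[OF that] differentiableI by blast
  moreover have "Ck_on k (\<lambda>x. frechet_derivative g (at x) v) U" for v
    using Suc.IH[of "\<lambda>x. frechet_derivative f (at x) v"] e Suc.prems(2) by simp
  ultimately show ?case by simp
qed

text \<open>Allows any explicit formula \<open>f'\<close> for the derivative, so that the closure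
  proofs need not compute \<open>frechet_derivative\<close>.\<close>

lemma Ck_on_SucI:
  assumes "open U" "\<And>x. x \<in> U \<Longrightarrow> (f has_derivative f' x) (at x)"
    and "\<And>v. Ck_on k (\<lambda>x. f' x v) U"
  shows "Ck_on (Suc k) f U"
proof -
  have "frechet_derivative f (at x) = f' x" if "x \<in> U" for x
    using frechet_derivative_at[OF assms(2)[OF that]] by simp
  then have "Ck_on k (\<lambda>x. frechet_derivative f (at x) v) U" for v
    using Ck_on_cong[OF assms(1) _ assms(3)[of v]] by simp
  moreover have "f differentiable at x" if "x \<in> U" for x
    using assms(2)[OF that] differentiableI by blast
  ultimately show ?thesis by simp
qed

lemma Ck_on_SucD:
  assumes "Ck_on (Suc k) f U"
  shows "x \<in> U \<Longrightarrow> (f has_derivative frechet_derivative f (at x)) (at x)"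
    and "Ck_on k (\<lambda>x. frechet_derivative f (at x) v) U"
  using assms by (simp_all add: frechet_derivative_works[symmetric])

lemma Ck_on_Suc_imp: "Ck_on (Suc k) f U \<Longrightarrow> Ck_on k f U"
proof (induction k arbitrary: f)
  case 0
  then show ?case
    by (auto intro!: differentiable_imp_continuous_on
        simp: differentiable_on_def differentiable_at_withinI)
next
  case (Suc k)
  then show ?case by (metis Ck_on.simps(2))
qed

lemma Ck_on_subset: "Ck_on k f U \<Longrightarrow> V \<subseteq> U \<Longrightarrow> Ck_on k f V"
  by (induction k arbitrary: f) (auto intro: continuous_on_subset)

lemma Ck_on_const: "open U \<Longrightarrow> Ck_on k (\<lambda>x. c) U"
proof (induction k arbitrary: c)
  case (Suc k)
  show ?case
    by (rule Ck_on_SucI[where f' = "\<lambda>x v. 0"]) (auto intro: Suc has_derivative_const)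
qed simp

lemma Ck_on_ident: "open U \<Longrightarrow> Ck_on k (\<lambda>x. x) U"
proof (cases k)
  case (Suc j)
  assume "open U"
  then show ?thesis unfolding Suc
    by (intro Ck_on_SucI[where f' = "\<lambda>x v. v"]) (auto intro: Ck_on_const has_derivative_ident)
qed simp

lemma Ck_on_add:
  assumes "open U"
  shows "Ck_on k f U \<Longrightarrow> Ck_on k g U \<Longrightarrow> Ck_on k (\<lambda>x. f x + g x) U"
proof (induction k arbitrary: f g)
  case 0
  then show ?case by (simp add: continuous_on_add)
next
  case (Suc k)
  show ?case
    by (rule Ck_on_SucI[OF assms
          has_derivative_add[OF Ck_on_SucD(1)[OF Suc.prems(1)] Ck_on_SucD(1)[OF Suc.prems(2)]]])
       (auto intro!: Suc.IH Ck_on_SucD(2)[OF Suc.prems(1)] Ck_on_SucD(2)[OF Suc.prems(2)])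
qed

text \<open>The product rule yields two products, each of one original factor and one directional
  derivative, and the induction hypothesis covers both. This serves scalar multiplication, the inner
  product and the cross product at once.\<close>

lemma (in bounded_bilinear) Ck_on:
  assumes "open U"
  shows "Ck_on k f U \<Longrightarrow> Ck_on k g U \<Longrightarrow> Ck_on k (\<lambda>x. prod (f x) (g x)) U"
proof (induction k arbitrary: f g)
  case 0
  then show ?case by (simp add: continuous_on)
next
  case (Suc k)
  show ?case
    by (rule Ck_on_SucI[OF assms
          FDERIV[OF Ck_on_SucD(1)[OF Suc.prems(1)] Ck_on_SucD(1)[OF Suc.prems(2)]]])
       (auto intro!: Suc.IH Ck_on_add assms Ck_on_SucD(2)[OF Suc.prems(1)]
          Ck_on_SucD(2)[OF Suc.prems(2)] Ck_on_Suc_imp[OF Suc.prems(1)] Ck_on_Suc_imp[OF Suc.prems(2)])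
qed

section \<open>Symmetry of second derivatives\<close>

text \<open>The mean value theorem is applied twice: in direction \<open>u\<close> to a difference
  of two values of \<open>F\<close>, then in direction \<open>v\<close> to the resulting difference
  of \<open>u\<close>-derivatives.\<close>

lemma second_difference_mvt:
  fixes F :: "'a::real_normed_vector \<Rightarrow> real"
  assumes F: "\<And>x. x \<in> ball p r \<Longrightarrow> (F has_derivative F' x) (at x)"
    and F': "\<And>x. x \<in> ball p r \<Longrightarrow> ((\<lambda>x. F' x u) has_derivative F'' x) (at x)"
    and h: "0 < h" "h * (norm u + norm v) < r"
  obtains x where "dist p x \<le> h * (norm u + norm v)"
    "F (p + h *\<^sub>R u + h *\<^sub>R v) - F (p + h *\<^sub>R u) - F (p + h *\<^sub>R v) + F p = h * (h * F'' x v)"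
proof -
  have d: "dist p (p + s *\<^sub>R u + t *\<^sub>R v) \<le> h * (norm u + norm v)"
    if "0 \<le> s" "s \<le> h" "0 \<le> t" "t \<le> h" for s t
  proof -
    have "norm (s *\<^sub>R u + t *\<^sub>R v) \<le> s * norm u + t * norm v"
      using norm_triangle_ineq[of "s *\<^sub>R u" "t *\<^sub>R v"] that by simp
    also have "\<dots> \<le> h * norm u + h * norm v"
      using that by (intro add_mono mult_right_mono) auto
    finally show ?thesis
      by (metis add.assoc add_diff_cancel_left' dist_commute dist_norm distrib_left)
  qed
  have in_ball: "p + s *\<^sub>R u + t *\<^sub>R v \<in> ball p r"
    if "0 \<le> s" "s \<le> h" "0 \<le> t" "t \<le> h" for s t
    using d[OF that] h by simp
  have D1: "((\<lambda>s. F (p + s *\<^sub>R u + t *\<^sub>R v)) has_real_derivative F' (p + s *\<^sub>R u + t *\<^sub>R v) u) (at s)"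
    if "0 \<le> s" "s \<le> h" "0 \<le> t" "t \<le> h" for s t
  proof -
    have a: "((\<lambda>s. p + s *\<^sub>R u + t *\<^sub>R v) has_derivative (\<lambda>s. s *\<^sub>R u)) (at s)"
      by (auto intro!: derivative_eq_intros)
    have "linear (F' (p + s *\<^sub>R u + t *\<^sub>R v))"
      using F[OF in_ball[OF that]] has_derivative_linear by blast
    then show ?thesis
      using has_derivative_compose[OF a F[OF in_ball[OF that]]]
      by (simp add: has_field_derivative_def linear_scale mult.commute[of _ "F' _ _"])
  qed
  have D2: "((\<lambda>t. F' (p + s *\<^sub>R u + t *\<^sub>R v) u) has_real_derivative F'' (p + s *\<^sub>R u + t *\<^sub>R v) v) (at t)"
    if "0 \<le> s" "s \<le> h" "0 \<le> t" "t \<le> h" for s t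
  proof -
    have a: "((\<lambda>t. p + s *\<^sub>R u + t *\<^sub>R v) has_derivative (\<lambda>t. t *\<^sub>R v)) (at t)"
      by (auto intro!: derivative_eq_intros)
    have "linear (F'' (p + s *\<^sub>R u + t *\<^sub>R v))"
      using F'[OF in_ball[OF that]] has_derivative_linear by blast
    then show ?thesis
      using has_derivative_compose[OF a F'[OF in_ball[OF that]]]
      by (simp add: has_field_derivative_def linear_scale mult.commute[of _ "F'' _ _"])
  qed
  \<comment> \<open>The term \<open>0 *\<^sub>R v\<close> keeps both halves in the shape of
    \<open>D1\<close>, with t = h and t = 0.\<close>
  let ?f = "\<lambda>s. F (p + s *\<^sub>R u + h *\<^sub>R v) - F (p + s *\<^sub>R u + 0 *\<^sub>R v)"
  let ?f' = "\<lambda>s. F' (p + s *\<^sub>R u + h *\<^sub>R v) u - F' (p + s *\<^sub>R u + 0 *\<^sub>R v) u"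
  have "\<exists>s. s > 0 \<and> s < h \<and> ?f h - ?f 0 = (h - 0) * ?f' s"
    by (rule MVT2[OF h(1)]) (rule DERIV_diff[OF D1 D1]; use h(1) in simp)
  then obtain s where s: "0 < s" "s < h" "?f h - ?f 0 = (h - 0) * ?f' s"
    by blast
  let ?g = "\<lambda>t. F' (p + s *\<^sub>R u + t *\<^sub>R v) u"
  have "\<exists>t. t > 0 \<and> t < h \<and> ?g h - ?g 0 = (h - 0) * F'' (p + s *\<^sub>R u + t *\<^sub>R v) v"
    by (rule MVT2[OF h(1)]) (rule D2; use s in simp)
  then obtain t where t: "0 < t" "t < h" "?g h - ?g 0 = (h - 0) * F'' (p + s *\<^sub>R u + t *\<^sub>R v) v"
    by blast
  show ?thesis
    using that[OF d[of s t]] s t by simp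
qed

text \<open>The second difference does not change when \<open>u\<close> and \<open>v\<close> are
  exchanged. The two orders of evaluation therefore equate one mixed derivative near
  \<open>p\<close> with the other, and continuity carries the equality to \<open>p\<close>.\<close>

lemma second_derivative_symmetric:
  fixes F :: "'a::real_normed_vector \<Rightarrow> real"
  assumes "open U" "p \<in> U"
    and F: "\<And>x. x \<in> U \<Longrightarrow> (F has_derivative F' x) (at x)"
    and Fu: "\<And>x. x \<in> U \<Longrightarrow> ((\<lambda>x. F' x u) has_derivative Fu x) (at x)"
    and Fv: "\<And>x. x \<in> U \<Longrightarrow> ((\<lambda>x. F' x v) has_derivative Fv x) (at x)"
    and cu: "continuous_on U (\<lambda>x. Fu x v)" and cv: "continuous_on U (\<lambda>x. Fv x u)"
  shows "Fu p v = Fv p u"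
proof (rule ccontr)
  assume ne: "Fu p v \<noteq> Fv p u"
  define e where "e = \<bar>Fu p v - Fv p u\<bar> / 2"
  have e: "e > 0" using ne by (simp add: e_def)
  obtain r where r: "r > 0" "ball p r \<subseteq> U"
    using assms(1,2) open_contains_ball by blast
  have "isCont (\<lambda>x. Fu x v) p" "isCont (\<lambda>x. Fv x u) p"
    using assms(1,2) cu cv continuous_on_eq_continuous_at by blast+
  then have "\<exists>d>0. \<forall>x. dist x p < d \<longrightarrow> dist (Fu x v) (Fu p v) < e"
    "\<exists>d>0. \<forall>x. dist x p < d \<longrightarrow> dist (Fv x u) (Fv p u) < e"
    using e unfolding continuous_at_eps_delta by blast+
  then obtain d1 d2 where d: "d1 > 0" "d2 > 0"
    "\<And>x. dist x p < d1 \<Longrightarrow> dist (Fu x v) (Fu p v) < e"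
    "\<And>x. dist x p < d2 \<Longrightarrow> dist (Fv x u) (Fv p u) < e"
    by blast
  define m where "m = min r (min d1 d2)"
  \<comment> \<open>The summand 1 keeps the denominator positive even for u = v = 0; the step is
    small enough for the ball and for both continuity estimates.\<close>
  define h where "h = m / 2 / (norm u + norm v + 1)"
  have m: "m > 0" using d r by (simp add: m_def)
  have h0: "h > 0" using m by (simp add: h_def add_nonneg_pos)
  have "h * (norm u + norm v) \<le> h * (norm u + norm v + 1)"
    using h0 by simp
  also have "\<dots> = m / 2"
  proof -
    have "norm u + norm v + 1 \<noteq> 0" by (smt (verit) norm_ge_zero)
    moreover have "m / 2 / k * k = m / 2" if "k \<noteq> 0" for k using that by simp
    ultimately show ?thesis unfolding h_def by blast
  qed
  also have "\<dots> < m" using m by simp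
  finally have hm: "h * (norm u + norm v) < m" .
  have hr: "h * (norm u + norm v) < r" "h * (norm v + norm u) < r"
    using hm by (simp_all add: m_def add.commute)
  have FB: "\<And>x. x \<in> ball p r \<Longrightarrow> (F has_derivative F' x) (at x)"
    "\<And>x. x \<in> ball p r \<Longrightarrow> ((\<lambda>x. F' x u) has_derivative Fu x) (at x)"
    "\<And>x. x \<in> ball p r \<Longrightarrow> ((\<lambda>x. F' x v) has_derivative Fv x) (at x)"
    using F Fu Fv r by blast+
  obtain x where x: "dist p x \<le> h * (norm u + norm v)"
    "F (p + h *\<^sub>R u + h *\<^sub>R v) - F (p + h *\<^sub>R u) - F (p + h *\<^sub>R v) + F p = h * (h * Fu x v)"
    using second_difference_mvt[OF FB(1,2) h0 hr(1)] by blast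
  obtain y where y: "dist p y \<le> h * (norm v + norm u)"
    "F (p + h *\<^sub>R v + h *\<^sub>R u) - F (p + h *\<^sub>R v) - F (p + h *\<^sub>R u) + F p = h * (h * Fv y u)"
    using second_difference_mvt[OF FB(1,3) h0 hr(2)] by blast
  have "h * (h * Fu x v) = h * (h * Fv y u)"
    using x(2) y(2) by (simp add: algebra_simps)
  then have "Fu x v = Fv y u" using h0 by simp
  moreover have "dist (Fu x v) (Fu p v) < e"
    using x(1) hm by (intro d(3)) (simp add: m_def dist_commute)
  moreover have "dist (Fv y u) (Fv p u) < e"
    using y(1) hm by (intro d(4)) (simp add: m_def dist_commute add.commute)
  ultimately have "\<bar>Fu p v - Fv p u\<bar> < e + e"
    unfolding dist_real_def by linarith
  then show False by (simp add: e_def)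
qed

section \<open>Calculus on the sphere\<close>

lemma smooth_map_extension:
  assumes "smooth_map f" "p \<in> S6"
  obtains U F where "open U" "p \<in> U" "\<And>k. Ck_on k F U" "\<And>x. x \<in> U \<inter> S6 \<Longrightarrow> F x = f x"
proof -
  obtain U F where *: "open U \<and> p \<in> U \<and> (\<forall>k. Ck_on k F U) \<and> (\<forall>x\<in>U \<inter> S6. F x = f x)"
    using bspec[OF assms(1)[unfolded smooth_map_def] assms(2)] by (elim exE) (rule that)
  show ?thesis by (rule that[of U F]) (use * in blast)+
qed

lemma smooth_mapI:
  assumes "\<And>p. p \<in> S6 \<Longrightarrow> \<exists>U F. open U \<and> p \<in> U \<and> (\<forall>k. Ck_on k F U) \<and> (\<forall>x\<in>U \<inter> S6. F x = f x)"
  shows "smooth_map f"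
  unfolding smooth_map_def by (intro ballI assms)

lemma smooth_map_cong:
  assumes f: "smooth_map f" and eq: "\<And>x. x \<in> S6 \<Longrightarrow> f x = g x"
  shows "smooth_map g"
proof (rule smooth_mapI)
  fix p :: R7 assume "p \<in> S6"
  then obtain U F where F: "open U" "p \<in> U" "\<And>k. Ck_on k F U" "\<And>x. x \<in> U \<inter> S6 \<Longrightarrow> F x = f x"
    using smooth_map_extension[OF f] by metis
  then show "\<exists>U F. open U \<and> p \<in> U \<and> (\<forall>k. Ck_on k F U) \<and> (\<forall>x\<in>U \<inter> S6. F x = g x)"
    using eq by (intro exI[of _ U] exI[of _ F]) auto
qed

lemma smooth_map_Ck_on_UNIV: "(\<And>k. Ck_on k f UNIV) \<Longrightarrow> smooth_map f"
  by (rule smooth_mapI) (intro exI[of _ UNIV] exI[of _ f], auto)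

lemma smooth_map_const: "smooth_map (\<lambda>x. c)"
  by (intro smooth_map_Ck_on_UNIV Ck_on_const open_UNIV)

lemma smooth_map_ident: "smooth_map (\<lambda>x. x)"
  by (intro smooth_map_Ck_on_UNIV Ck_on_ident open_UNIV)

text \<open>Local extensions of the two maps are combined on the intersection of their
  domains.\<close>

lemma smooth_map_combine:
  assumes f: "smooth_map f" and g: "smooth_map g"
    and op: "\<And>k (U :: R7 set) F G. open U \<Longrightarrow> Ck_on k F U \<Longrightarrow> Ck_on k G U \<Longrightarrow> Ck_on k (\<lambda>x. op (F x) (G x)) U"
  shows "smooth_map (\<lambda>x. op (f x) (g x))"
proof (rule smooth_mapI)
  fix p :: R7 assume p: "p \<in> S6"
  obtain U F where F: "open U" "p \<in> U" "\<And>k. Ck_on k F U" "\<And>x. x \<in> U \<inter> S6 \<Longrightarrow> F x = f x"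
    using smooth_map_extension[OF f p] by metis
  obtain V G where G: "open V" "p \<in> V" "\<And>k. Ck_on k G V" "\<And>x. x \<in> V \<inter> S6 \<Longrightarrow> G x = g x"
    using smooth_map_extension[OF g p] by metis
  have UV: "open (U \<inter> V)" "p \<in> U \<inter> V" using F G by auto
  have "Ck_on k (\<lambda>x. op (F x) (G x)) (U \<inter> V)" for k
    by (rule op[OF UV(1) Ck_on_subset[OF F(3)] Ck_on_subset[OF G(3)]]) auto
  then show "\<exists>U Fa. open U \<and> p \<in> U \<and> (\<forall>k. Ck_on k Fa U) \<and> (\<forall>x\<in>U \<inter> S6. Fa x = op (f x) (g x))"
    using F(4) G(4)
    by (intro exI[of _ "U \<inter> V"] exI[of _ "\<lambda>x. op (F x) (G x)"] conjI UV) auto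
qed

lemma smooth_map_add:
  assumes "smooth_map f" "smooth_map g"
  shows "smooth_map (\<lambda>x. f x + g x)"
  by (rule smooth_map_combine[OF assms]) (erule (2) Ck_on_add)

lemma (in bounded_bilinear) smooth_map:
  assumes "smooth_map f" "smooth_map g"
  shows "smooth_map (\<lambda>x. prod (f x) (g x))"
  by (rule smooth_map_combine[OF assms]) (erule (2) Ck_on)

lemmas smooth_map_scaleR = bounded_bilinear.smooth_map[OF bounded_bilinear_scaleR]
lemmas smooth_map_inner = bounded_bilinear.smooth_map[OF bounded_bilinear_inner]

lemma smooth_map_minus:
  assumes "smooth_map f"
  shows "smooth_map (\<lambda>x. - f x)"
  using smooth_map_scaleR[OF smooth_map_const[of "-1"] assms] by simp

lemma smooth_map_diff: "smooth_map f \<Longrightarrow> smooth_map g \<Longrightarrow> smooth_map (\<lambda>x. f x - g x)"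
  unfolding diff_conv_add_uminus by (intro smooth_map_add smooth_map_minus)

section \<open>Derivatives along curves in the sphere\<close>

lemma sgn_curve_nonzero:
  assumes "p \<in> S6" "v \<in> tangent p"
  shows "p + t *\<^sub>R v \<noteq> 0"
proof
  assume "p + t *\<^sub>R v = 0"
  then have "p \<bullet> (p + t *\<^sub>R v) = 0" by simp
  then show False using assms by (simp add: inner_add_right tangent_def dot_square_norm)
qed

lemma sgn_curve_in_S6: "p \<in> S6 \<Longrightarrow> v \<in> tangent p \<Longrightarrow> sgn (p + t *\<^sub>R v) \<in> S6"
  using sgn_curve_nonzero[of p v t] by (simp add: norm_sgn)

lemma sgn_curve_0: "p \<in> S6 \<Longrightarrow> sgn (p + 0 *\<^sub>R v) = p"
  by (simp add: sgn_div_norm)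

text \<open>Since \<open>v\<close> is orthogonal to \<open>p\<close>, the squared norm of p + tv is
  1 + t^2 |v|^2. It is stationary at t = 0, so normalizing does not change the velocity
  there.\<close>

lemma sgn_curve_has_vector_derivative:
  assumes p: "p \<in> S6" and v: "v \<in> tangent p"
  shows "((\<lambda>t. sgn (p + t *\<^sub>R v)) has_vector_derivative v) (at 0)"
proof -
  have "norm (p + t *\<^sub>R v) = sqrt (1 + t\<^sup>2 * (v \<bullet> v))" for t
    using p v by (simp add: norm_eq_sqrt_inner inner_add_left inner_add_right tangent_def
        inner_commute power2_eq_square)
  then have e: "sgn (p + t *\<^sub>R v) = inverse (sqrt (1 + t\<^sup>2 * (v \<bullet> v))) *\<^sub>R (p + t *\<^sub>R v)" for t
    by (simp add: sgn_div_norm)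
  show ?thesis
    unfolding e by (auto intro!: derivative_eq_intros)
qed

text \<open>The vector-valued form of \<open>dderiv\<close>, so that vector fields can be
  differentiated as maps into \<real>^7.\<close>

definition sphere_deriv :: "(R7 \<Rightarrow> 'b::real_normed_vector) \<Rightarrow> R7 \<Rightarrow> R7 \<Rightarrow> 'b" where
  "sphere_deriv f p v = vector_derivative (\<lambda>t. f (sgn (p + t *\<^sub>R v))) (at 0)"

lemma dderiv_eq: "dderiv = sphere_deriv"
  by (intro ext) (simp add: dderiv_def sphere_deriv_def)

lemma sphere_deriv_eqI:
  "((\<lambda>t. f (sgn (p + t *\<^sub>R v))) has_vector_derivative d) (at 0) \<Longrightarrow> sphere_deriv f p v = d"
  unfolding sphere_deriv_def by (rule vector_derivative_at)

text \<open>This is the chain rule: for small t the curve stays in \<open>U\<close> and in the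
  sphere, where \<open>F\<close> and \<open>f\<close> coincide.\<close>

lemma sphere_deriv_extension:
  assumes p: "p \<in> S6" and v: "v \<in> tangent p"
    and U: "open U" "p \<in> U" "\<And>x. x \<in> U \<inter> S6 \<Longrightarrow> F x = f x"
    and F: "(F has_derivative F') (at p)"
  shows "((\<lambda>t. f (sgn (p + t *\<^sub>R v))) has_vector_derivative F' v) (at 0)"
proof -
  let ?c = "\<lambda>t. sgn (p + t *\<^sub>R v)"
  have c: "(?c has_derivative (\<lambda>t. t *\<^sub>R v)) (at 0)"
    using sgn_curve_has_vector_derivative[OF p v] by (simp add: has_vector_derivative_def)
  have c0: "?c 0 = p" using sgn_curve_0[OF p, of v] .
  have "((\<lambda>t. F (?c t)) has_derivative (\<lambda>t. F' (t *\<^sub>R v))) (at 0)"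
    using has_derivative_compose[OF c] F c0 by simp
  then have d: "((\<lambda>t. F (?c t)) has_vector_derivative F' v) (at 0)"
    using has_derivative_linear[OF F] by (simp add: has_vector_derivative_def linear_scale)
  have "isCont ?c 0" using has_derivative_continuous[OF c] .
  then have "eventually (\<lambda>t. ?c t \<in> U) (at 0)"
    using U(1,2) c0 unfolding continuous_within
    by (metis topological_tendstoD)
  then have ev: "eventually (\<lambda>t. F (?c t) = f (?c t)) (at 0)"
    by eventually_elim (use U(3) sgn_curve_in_S6[OF p v] in blast)
  \<comment> \<open>The filter \<open>at 0\<close> omits 0 itself, so agreement at that parameter is
    supplied separately.\<close>
  have "F (?c 0) = f (?c 0)" unfolding c0 using U p by blast
  then show ?thesis
    unfolding has_vector_derivative_def
    by (rule has_derivative_transform_eventually[OF d[unfolded has_vector_derivative_def] ev _ UNIV_I])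
qed

lemma has_sphere_deriv:
  assumes f: "smooth_map f" and p: "p \<in> S6" and v: "v \<in> tangent p"
  shows "((\<lambda>t. f (sgn (p + t *\<^sub>R v))) has_vector_derivative sphere_deriv f p v) (at 0)"
proof -
  obtain U F where F: "open U" "p \<in> U" "\<And>k. Ck_on k F U" "\<And>x. x \<in> U \<inter> S6 \<Longrightarrow> F x = f x"
    using smooth_map_extension[OF f p] by metis
  show ?thesis
    using sphere_deriv_extension[OF p v F(1,2,4) Ck_on_SucD(1)[OF F(3)[of "Suc 0"] F(2)]]
      sphere_deriv_eqI by metis
qed

lemma sphere_deriv_cong:
  assumes "\<And>x. x \<in> S6 \<Longrightarrow> f x = g x" "p \<in> S6" "v \<in> tangent p"
  shows "sphere_deriv f p v = sphere_deriv g p v"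
proof -
  have "(\<lambda>t. f (sgn (p + t *\<^sub>R v))) = (\<lambda>t. g (sgn (p + t *\<^sub>R v)))"
    by (rule ext, rule assms(1), rule sgn_curve_in_S6[OF assms(2,3)])
  then show ?thesis by (simp add: sphere_deriv_def)
qed

lemma sphere_deriv_const: "sphere_deriv (\<lambda>x. c) p v = 0"
  unfolding sphere_deriv_def by simp

lemma sphere_deriv_ident: "p \<in> S6 \<Longrightarrow> v \<in> tangent p \<Longrightarrow> sphere_deriv (\<lambda>x. x) p v = v"
  by (rule sphere_deriv_eqI) (rule sgn_curve_has_vector_derivative)

lemma sphere_deriv_add:
  assumes "smooth_map f" "smooth_map g" "p \<in> S6" "v \<in> tangent p"
  shows "sphere_deriv (\<lambda>x. f x + g x) p v = sphere_deriv f p v + sphere_deriv g p v"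
  by (rule sphere_deriv_eqI) (intro has_vector_derivative_add has_sphere_deriv assms)

lemma (in bounded_bilinear) sphere_deriv:
  assumes "smooth_map f" "smooth_map g" "p \<in> S6" "v \<in> tangent p"
  shows "sphere_deriv (\<lambda>x. prod (f x) (g x)) p v
    = prod (f p) (sphere_deriv g p v) + prod (sphere_deriv f p v) (g p)"
  by (rule sphere_deriv_eqI)
    (use has_vector_derivative[OF has_sphere_deriv[OF assms(1,3,4)] has_sphere_deriv[OF assms(2,3,4)]]
      sgn_curve_0[OF assms(3), of v] in simp)

lemmas sphere_deriv_scaleR = bounded_bilinear.sphere_deriv[OF bounded_bilinear_scaleR]
lemmas sphere_deriv_inner = bounded_bilinear.sphere_deriv[OF bounded_bilinear_inner]

lemma sphere_deriv_diff:
  assumes "smooth_map f" "smooth_map g" "p \<in> S6" "v \<in> tangent p"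
  shows "sphere_deriv (\<lambda>x. f x - g x) p v = sphere_deriv f p v - sphere_deriv g p v"
  by (rule sphere_deriv_eqI) (intro has_vector_derivative_diff has_sphere_deriv assms)

lemma smooth_vfD:
  "smooth_vf X \<Longrightarrow> smooth_map X" "smooth_vf X \<Longrightarrow> p \<in> S6 \<Longrightarrow> X p \<in> tangent p"
  by (auto simp: smooth_vf_def)

text \<open>Differentiating x \<bullet> Y x = 0 gives this second fundamental form of the sphere.
  Its symmetry in \<open>v\<close> and \<open>Y p\<close> makes normal parts cancel in
  brackets.\<close>

lemma inner_sphere_deriv_vf:
  assumes Y: "smooth_vf Y" and p: "p \<in> S6" and v: "v \<in> tangent p"
  shows "p \<bullet> sphere_deriv Y p v = - (v \<bullet> Y p)"
proof -
  have "sphere_deriv (\<lambda>x. x \<bullet> Y x) p v = sphere_deriv (\<lambda>x. 0) p v"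
    by (rule sphere_deriv_cong) (use smooth_vfD(2)[OF Y] p v in \<open>auto simp: tangent_def\<close>)
  then show ?thesis
    using sphere_deriv_inner[OF smooth_map_ident smooth_vfD(1)[OF Y] p v]
    by (simp add: sphere_deriv_const sphere_deriv_ident[OF p v])
qed

text \<open>
  \<open>B\<close> and \<open>L\<close> are the second and first derivative of a local extension of \<open>f\<close>; the symmetry of \<open>B\<close>
  is what makes the commutator of two vector fields a derivation.
\<close>
lemma second_sphere_deriv:
  assumes f: "smooth_fun f" and p: "p \<in> S6"
  obtains L B where "linear L" "\<And>v. v \<in> tangent p \<Longrightarrow> dderiv f p v = L v"
    "\<And>u v. B u v = B v u"
    "\<And>X Y. smooth_vf X \<Longrightarrow> smooth_vf Y \<Longrightarrow>
       vf_apply X (vf_apply Y f) p = B (X p) (Y p) + L (sphere_deriv Y p (X p))"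
proof -
  obtain U F where F: "open U" "p \<in> U" "\<And>k. Ck_on k F U" "\<And>x. x \<in> U \<inter> S6 \<Longrightarrow> F x = f x"
    using smooth_map_extension[OF f p] by metis
  define F' where "F' x = frechet_derivative F (at x)" for x
  define F2 where "F2 u x = frechet_derivative (\<lambda>x. F' x u) (at x)" for u x
  have D1: "(F has_derivative F' x) (at x)" if "x \<in> U" for x
    unfolding F'_def using Ck_on_SucD(1)[OF F(3) that] .
  have C1: "Ck_on k (\<lambda>x. F' x u) U" for k u
    unfolding F'_def by (rule Ck_on_SucD(2)[OF F(3)])
  have D2: "((\<lambda>x. F' x u) has_derivative F2 u x) (at x)" if "x \<in> U" for x u
    unfolding F2_def using Ck_on_SucD(1)[OF C1 that] .
  have "Ck_on 0 (\<lambda>x. F2 u x v) U" for u v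
    unfolding F2_def by (rule Ck_on_SucD(2)[OF C1])
  then have F2_sym: "F2 u p v = F2 v p u" for u v
    by (intro second_derivative_symmetric[OF F(1,2) D1 D2 D2]) auto
  have df: "dderiv f q v = F' q v" if "q \<in> U \<inter> S6" "v \<in> tangent q" for q v
    unfolding dderiv_eq
    by (rule sphere_deriv_eqI) (use that in \<open>auto intro!: sphere_deriv_extension[OF _ _ F(1) _ F(4) D1]\<close>)
  have expand: "L y = (\<Sum>i\<in>UNIV. y $ i * L (axis i 1))" if "linear L" for L :: "R7 \<Rightarrow> real" and y
  proof -
    have "L y = L (\<Sum>i\<in>UNIV. y $ i *\<^sub>R axis i 1)"
      by (simp add: basis_expansion flip: scalar_mult_eq_scaleR)
    then show ?thesis by (simp add: linear_sum[OF that] linear_scale[OF that])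
  qed
  have lin: "linear (F' x)" if "x \<in> U" for x
    using has_derivative_linear[OF D1[OF that]] .
  have "vf_apply X (vf_apply Y f) p = F2 (X p) p (Y p) + F' p (sphere_deriv Y p (X p))"
    if X: "smooth_vf X" and Y: "smooth_vf Y" for X Y
  proof -
    obtain V G where G: "open V" "p \<in> V" "\<And>k. Ck_on k G V" "\<And>x. x \<in> V \<inter> S6 \<Longrightarrow> G x = Y x"
      using smooth_map_extension[OF smooth_vfD(1)[OF Y] p] by metis
    define G' where "G' = frechet_derivative G (at p)"
    have DG: "(G has_derivative G') (at p)"
      unfolding G'_def using Ck_on_SucD(1)[OF G(3) G(2)] .
    have tX: "X p \<in> tangent p" using smooth_vfD(2)[OF X p] .
    have sY: "sphere_deriv Y p (X p) = G' (X p)"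
      by (rule sphere_deriv_eqI) (rule sphere_deriv_extension[OF p tX G(1,2,4) DG])
    \<comment> \<open>In F'(x)(Y x) both the point and the direction vary. Expanding the direction
      in the standard basis reduces the derivative to the product rule for finitely many
      products.\<close>
    define H where "H x = (\<Sum>i\<in>UNIV. G x $ i * F' x (axis i 1))" for x
    have DH: "(H has_derivative
        (\<lambda>h. \<Sum>i\<in>UNIV. G p $ i * F2 (axis i 1) p h + G' h $ i * F' p (axis i 1))) (at p)"
      unfolding H_def
      by (intro has_derivative_sum has_derivative_mult D2 F(2)
          bounded_linear.has_derivative[OF bounded_linear_vec_nth] DG)
    have HU: "H x = vf_apply Y f x" if x: "x \<in> (U \<inter> V) \<inter> S6" for x
      using x smooth_vfD(2)[OF Y, of x] df[of x "Y x"] expand[OF lin[of x], of "Y x"] G(4)[of x]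
      by (simp add: vf_apply_def H_def)
    have "vf_apply X (vf_apply Y f) p
        = (\<Sum>i\<in>UNIV. G p $ i * F2 (axis i 1) p (X p) + G' (X p) $ i * F' p (axis i 1))"
      unfolding vf_apply_def[of X] dderiv_eq
      by (rule sphere_deriv_eqI)
        (rule sphere_deriv_extension[OF p tX open_Int[OF F(1) G(1)] _ HU DH], use F G in auto)
    \<comment> \<open>Symmetry moves the basis vectors into the last slot of \<open>F2\<close>,
      where linearity reassembles the sum.\<close>
    also have "\<dots> = (\<Sum>i\<in>UNIV. G p $ i * F2 (X p) p (axis i 1)) + (\<Sum>i\<in>UNIV. G' (X p) $ i * F' p (axis i 1))"
      by (simp add: sum.distrib F2_sym[of _ "X p"])
    also have "\<dots> = F2 (X p) p (G p) + F' p (G' (X p))"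
      using expand[OF has_derivative_linear[OF D2[OF F(2), of "X p"]], of "G p"]
        expand[OF lin[OF F(2)], of "G' (X p)"] by simp
    finally show ?thesis using sY G(4)[of p] G(2) p by simp
  qed
  then show ?thesis
    using that[of "F' p" "\<lambda>u. F2 u p"] lin[OF F(2)] df F(2) p F2_sym by auto
qed

text \<open>For existence, the symmetric second-order parts of the two compositions cancel, and what
  remains is a first derivative along a tangent vector. For uniqueness, restrictions of linear
  functions suffice as test functions.\<close>

lemma lie_bracket_eq:
  assumes X: "smooth_vf X" and Y: "smooth_vf Y" and p: "p \<in> S6"
  shows "lie_bracket X Y p = sphere_deriv Y p (X p) - sphere_deriv X p (Y p)"
  unfolding lie_bracket_def
proof (rule the_equality, intro conjI allI impI)
  let ?v = "sphere_deriv Y p (X p) - sphere_deriv X p (Y p)"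
  show t: "?v \<in> tangent p"
    using inner_sphere_deriv_vf[OF Y p smooth_vfD(2)[OF X p]]
      inner_sphere_deriv_vf[OF X p smooth_vfD(2)[OF Y p]]
    by (simp add: tangent_def inner_diff_right inner_commute)
  show "dderiv f p ?v = vf_apply X (vf_apply Y f) p - vf_apply Y (vf_apply X f) p"
    if "smooth_fun f" for f
  proof (rule second_sphere_deriv[OF that p])
    fix L B assume "linear L" "\<And>v. v \<in> tangent p \<Longrightarrow> dderiv f p v = L v"
      "\<And>u v. B u v = B v u"
      "\<And>X Y. smooth_vf X \<Longrightarrow> smooth_vf Y \<Longrightarrow>
       vf_apply X (vf_apply Y f) p = B (X p) (Y p) + L (sphere_deriv Y p (X p))"
    then show ?thesis
      using t X Y by (simp add: linear_diff)
  qed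
next
  fix v assume v: "v \<in> tangent p \<and> (\<forall>f. smooth_fun f \<longrightarrow>
        dderiv f p v = vf_apply X (vf_apply Y f) p - vf_apply Y (vf_apply X f) p)"
  show "v = sphere_deriv Y p (X p) - sphere_deriv X p (Y p)"
  proof (rule vector_eq_ldot[THEN iffD1], intro allI)
    fix e :: R7
    \<comment> \<open>The derivative of this function along a tangent vector is the inner product
      with \<open>e\<close>, and \<open>e\<close> is arbitrary, so such functions determine
      \<open>v\<close>.\<close>
    let ?f = "\<lambda>x. e \<bullet> x"
    have s: "smooth_fun ?f" by (intro smooth_map_inner smooth_map_const smooth_map_ident)
    have d: "dderiv ?f p w = e \<bullet> w" if "w \<in> tangent p" for w
      using sphere_deriv_inner[OF smooth_map_const smooth_map_ident p that]
      by (simp add: dderiv_eq sphere_deriv_const sphere_deriv_ident[OF p that])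
    have vf: "vf_apply A (vf_apply B ?f) p = e \<bullet> sphere_deriv B p (A p)"
      if A: "smooth_vf A" and B: "smooth_vf B" for A B
    proof -
      have "vf_apply A (vf_apply B ?f) p = sphere_deriv (\<lambda>x. e \<bullet> B x) p (A p)"
        unfolding vf_apply_def[of A] dderiv_eq
      proof (rule sphere_deriv_cong)
        fix x :: R7 assume x: "x \<in> S6"
        show "vf_apply B ?f x = e \<bullet> B x"
          using sphere_deriv_inner[OF smooth_map_const smooth_map_ident x smooth_vfD(2)[OF B x]]
          by (simp add: vf_apply_def dderiv_eq sphere_deriv_const sphere_deriv_ident[OF x smooth_vfD(2)[OF B x]])
      qed (use p smooth_vfD(2)[OF A p] in auto)
      also have "\<dots> = e \<bullet> sphere_deriv B p (A p)"
        using sphere_deriv_inner[OF smooth_map_const smooth_vfD(1)[OF B] p smooth_vfD(2)[OF A p]]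
        by (simp add: sphere_deriv_const)
      finally show ?thesis .
    qed
    show "e \<bullet> v = e \<bullet> (sphere_deriv Y p (X p) - sphere_deriv X p (Y p))"
      using v[THEN conjunct2, rule_format, OF s] d[OF v[THEN conjunct1]] vf[OF X Y] vf[OF Y X]
      by (simp add: inner_diff_right)
  qed
qed

section \<open>Projected fields and the Levi-Civita connection\<close>

text \<open>For a unit vector \<open>p\<close> this is the orthogonal projection onto
  \<open>tangent p\<close>. With \<open>w\<close> fixed and \<open>p\<close> varying it is a smooth
  field, which extends \<open>w\<close> if \<open>w\<close> is tangent at the given point.\<close>

definition tproj :: "R7 \<Rightarrow> R7 \<Rightarrow> R7" where
  "tproj p w = w - (p \<bullet> w) *\<^sub>R p"

lemma tproj_tangent: "p \<in> S6 \<Longrightarrow> tproj p w \<in> tangent p"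
  by (simp add: tproj_def tangent_def inner_diff_right dot_square_norm)

lemma inner_tproj: "v \<in> tangent p \<Longrightarrow> v \<bullet> tproj p w = v \<bullet> w"
  by (simp add: tproj_def tangent_def inner_diff_right inner_commute)

lemma tproj_eq: "u \<in> tangent p \<Longrightarrow> tproj p u = u"
  by (simp add: tproj_def tangent_def)

lemma smooth_vf_tproj: "smooth_vf (\<lambda>q. tproj q u)"
  unfolding smooth_vf_def
proof (intro conjI ballI)
  show "smooth_map (\<lambda>q. tproj q u)"
    unfolding tproj_def
    by (intro smooth_map_diff smooth_map_scaleR smooth_map_inner smooth_map_const smooth_map_ident)
qed (rule tproj_tangent)

text \<open>The projected ambient derivative satisfies the same torsion and metric identities as
  \<open>D\<close>. The usual uniqueness argument for the Levi-Civita connection then applies to the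
  difference \<open>S\<close>.\<close>

lemma levi_civita_eq:
  assumes D: "levi_civita D" and X: "smooth_vf X" and Y: "smooth_vf Y" and p: "p \<in> S6"
  shows "D X Y p = tproj p (sphere_deriv Y p (X p))"
proof -
  define S where "S X Y = D X Y p - tproj p (sphere_deriv Y p (X p))" for X Y
  have tD: "D X Y p \<in> tangent p" if "smooth_vf X" "smooth_vf Y" for X Y
  proof (rule smooth_vfD(2)[OF _ p])
    show "smooth_vf (D X Y)" using D that by (simp add: levi_civita_def affine_connection_def)
  qed
  have tS: "S X Y \<in> tangent p" if "smooth_vf X" "smooth_vf Y" for X Y
    using tD[OF that] tproj_tangent[OF p, of "sphere_deriv Y p (X p)"]
    by (simp add: S_def tangent_def inner_diff_right)
  have S_sym: "S X Y = S Y X" if "smooth_vf X" "smooth_vf Y" for X Y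
  proof -
    have "D X Y p - D Y X p = sphere_deriv Y p (X p) - sphere_deriv X p (Y p)"
      using D that p by (simp add: levi_civita_def torsion_free_def lie_bracket_eq)
    moreover have "p \<bullet> sphere_deriv Y p (X p) = p \<bullet> sphere_deriv X p (Y p)"
      using inner_sphere_deriv_vf[OF that(2) p smooth_vfD(2)[OF that(1) p]]
        inner_sphere_deriv_vf[OF that(1) p smooth_vfD(2)[OF that(2) p]]
      by (simp add: inner_commute)
    ultimately show ?thesis by (simp add: S_def tproj_def algebra_simps)
  qed
  have skew: "S X Y \<bullet> Z p = - (S X Z \<bullet> Y p)"
    if X: "smooth_vf X" and Y: "smooth_vf Y" and Z: "smooth_vf Z" for X Y Z
  proof -
    have "D X Y p \<bullet> Z p + Y p \<bullet> D X Z p = vf_apply X (\<lambda>q. round_g q (Y q) (Z q)) p"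
      using D X Y Z p by (simp add: levi_civita_def metric_connection_def round_g_def)
    also have "\<dots> = Y p \<bullet> sphere_deriv Z p (X p) + sphere_deriv Y p (X p) \<bullet> Z p"
      unfolding vf_apply_def dderiv_eq round_g_def
      by (rule sphere_deriv_inner[OF smooth_vfD(1)[OF Y] smooth_vfD(1)[OF Z] p smooth_vfD(2)[OF X p]])
    finally show ?thesis
      using inner_tproj[OF smooth_vfD(2)[OF Z p], of "sphere_deriv Y p (X p)"]
        inner_tproj[OF smooth_vfD(2)[OF Y p], of "sphere_deriv Z p (X p)"]
      by (simp add: S_def inner_diff_left inner_diff_right inner_commute)
  qed
  txt \<open>
    \<open>(X, Y, Z) \<mapsto> \<langle>S X Y, Z\<rangle>\<close> is symmetric in the first two and skew in the last two arguments,
    hence zero.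
  \<close>
  have "S X Y \<bullet> Z p = 0" if Z: "smooth_vf Z" for Z
    using skew[OF X Y Z] skew[OF Y Z X] skew[OF Z X Y] S_sym[OF X Z] S_sym[OF Z Y] S_sym[OF Y X]
    by simp
  \<comment> \<open>The test field is chosen to have the value \<open>S X Y\<close> at
    \<open>p\<close>, so the squared norm of \<open>S X Y\<close> vanishes.\<close>
  from this[OF smooth_vf_tproj[of "S X Y"]] have "S X Y = 0"
    by (simp add: tproj_eq[OF tS[OF X Y]])
  then show ?thesis by (simp add: S_def)
qed

section \<open>Algebra of the cross product\<close>

lemma cross7_add_right: "cross7 x (y + z) = cross7 x y + cross7 x z"
  and cross7_add_left: "cross7 (x + y) z = cross7 x z + cross7 y z"
  and cross7_scaleR_right: "cross7 x (s *\<^sub>R y) = s *\<^sub>R cross7 x y"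
  and cross7_scaleR_left: "cross7 (s *\<^sub>R x) y = s *\<^sub>R cross7 x y"
  by (simp_all add: vec_eq_iff cross7_nth algebra_simps)

lemma bounded_bilinear_cross7: "bounded_bilinear cross7"
  unfolding bilinear_conv_bounded_bilinear[symmetric] bilinear_def
  by (auto intro!: linearI simp: cross7_add_left cross7_add_right cross7_scaleR_left cross7_scaleR_right)

lemmas cross7_simps = cross7_add_left cross7_add_right cross7_scaleR_left cross7_scaleR_right
  bounded_bilinear.minus_left[OF bounded_bilinear_cross7]
  bounded_bilinear.minus_right[OF bounded_bilinear_cross7]
  bounded_bilinear.diff_left[OF bounded_bilinear_cross7]
  bounded_bilinear.diff_right[OF bounded_bilinear_cross7]
  bounded_bilinear.zero_left[OF bounded_bilinear_cross7]
  bounded_bilinear.zero_right[OF bounded_bilinear_cross7]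

lemma cross7_self: "cross7 x x = 0"
  by (simp add: vec_eq_iff cross7_nth algebra_simps)

lemma cross7_anticommute: "cross7 y x = - cross7 x y"
  by (simp add: vec_eq_iff cross7_nth algebra_simps)

text \<open>Cross multiplication by \<open>x\<close> is skew-adjoint; together with
  \<open>cross7_anticommute\<close> this makes the triple product alternating.\<close>

lemma inner_cross7_swap: "z \<bullet> cross7 x y = - (cross7 x z \<bullet> y)"
  by (simp add: inner_vec_def sum_7 cross7_coords algebra_simps)

lemma inner_cross7_right: "y \<bullet> cross7 x y = 0"
  using inner_cross7_swap[of y x y] by (simp add: inner_commute)

lemma inner_cross7_cross7: "cross7 x y \<bullet> cross7 x z = (x \<bullet> x) * (y \<bullet> z) - (x \<bullet> y) * (x \<bullet> z)"
  using inner_cross7_swap[of "cross7 x z" x y]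
  by (simp add: cross7_cross7 inner_diff_right inner_commute)

text \<open>This is the polarization of \<open>cross7_cross7\<close>. For mutually orthogonal
  vectors the right-hand side vanishes, which lets a factor \<open>p\<close> be moved out of a
  product at the cost of a sign.\<close>

lemma cross7_alternative:
  "cross7 (cross7 x y) z + cross7 x (cross7 y z) = (2 * (x \<bullet> z)) *\<^sub>R y - (x \<bullet> y) *\<^sub>R z - (y \<bullet> z) *\<^sub>R x"
  by (simp add: vec_eq_iff forall_7 inner_vec_def sum_7 cross7_coords algebra_simps)

lemma J6_tangent: "J6 p v \<in> tangent p"
  by (simp add: tangent_def J6_def inner_cross7_left)

lemma J6_J6: "p \<in> S6 \<Longrightarrow> v \<in> tangent p \<Longrightarrow> J6 p (J6 p v) = - v"
  by (simp add: J6_def cross7_cross7 tangent_def dot_square_norm)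

lemma tangent_closed:
  "0 \<in> tangent p" "u \<in> tangent p \<Longrightarrow> v \<in> tangent p \<Longrightarrow> u + v \<in> tangent p"
  "u \<in> tangent p \<Longrightarrow> v \<in> tangent p \<Longrightarrow> u - v \<in> tangent p"
  "u \<in> tangent p \<Longrightarrow> s *\<^sub>R u \<in> tangent p" "u \<in> tangent p \<Longrightarrow> - u \<in> tangent p"
  by (simp_all add: tangent_def inner_add_right inner_diff_right)

lemma tangent_eqI:
  assumes "u \<in> tangent p" "v \<in> tangent p" "\<And>x. x \<in> tangent p \<Longrightarrow> u \<bullet> x = v \<bullet> x"
  shows "u = v"
proof -
  have "(u - v) \<bullet> (u - v) = 0"
    using assms(3)[OF tangent_closed(3)[OF assms(1,2)]] by (simp add: inner_diff_left)
  then show ?thesis by simp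
qed

section \<open>The generalized tangent bundle under the identification of vectors and covectors\<close>

text \<open>
  \<open>gvec_rep p e x z\<close>: in the fibre at \<open>p\<close> (hence with the covector compared only on tangent vectors),
  \<open>e\<close> is \<open>x + g(z, \<cdot>)\<close>.
\<close>
definition gvec_rep :: "R7 \<Rightarrow> gvec \<Rightarrow> R7 \<Rightarrow> R7 \<Rightarrow> bool" where
  "gvec_rep p e x z \<longleftrightarrow> fst e = x \<and> x \<in> tangent p \<and> z \<in> tangent p \<and> (\<forall>u\<in>tangent p. snd e u = z \<bullet> u)"

lemma gvec_rep_gdiff:
  "gvec_rep p e x z \<Longrightarrow> gvec_rep p e' x' z' \<Longrightarrow> gvec_rep p (e \<ominus>\<^sub>E e') (x - x') (z - z')"
  by (auto simp: gvec_rep_def gdiff_def inner_diff_left tangent_closed)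

lemma gvec_rep_gadd:
  "gvec_rep p e x z \<Longrightarrow> gvec_rep p e' x' z' \<Longrightarrow> gvec_rep p (e \<oplus>\<^sub>E e') (x + x') (z + z')"
  by (auto simp: gvec_rep_def gadd_def inner_add_left tangent_closed)

lemma gvec_rep_gscale:
  "gvec_rep p e x z \<Longrightarrow> gvec_rep p (s \<odot>\<^sub>E e) (s *\<^sub>R x) (s *\<^sub>R z)"
  by (auto simp: gvec_rep_def gscale_def tangent_closed)

lemma gvec_rep_eq_gzero:
  assumes "gvec_rep p e x z" "eq_at p e gzero"
  shows "x = 0" "z = 0"
proof -
  show "x = 0" using assms by (simp add: gvec_rep_def eq_at_def gzero_def)
  have "z \<bullet> z = 0" using assms by (simp add: gvec_rep_def eq_at_def gzero_def)
  then show "z = 0" by simp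
qed

lemma form_inv_round_g:
  assumes "z \<in> tangent p" "\<And>u. u \<in> tangent p \<Longrightarrow> \<alpha> u = z \<bullet> u"
  shows "form_inv round_g p \<alpha> = z"
  unfolding form_inv_def round_g_def
  using assms by (intro the_equality) (auto intro: tangent_eqI)

text \<open>Because \<omega>(v, -) = g(Jv, -), inverting \<omega> means solving Jv = z, and J^2 = -1
  gives v = -Jz.\<close>

lemma form_inv_omega6:
  assumes "p \<in> S6" and "z \<in> tangent p" "\<And>u. u \<in> tangent p \<Longrightarrow> \<alpha> u = z \<bullet> u"
  shows "form_inv omega6 p \<alpha> = - J6 p z"
  unfolding form_inv_def omega6_def round_g_def
proof (rule the_equality)
  show "- J6 p z \<in> tangent p \<and> (\<forall>u\<in>tangent p. J6 p (- J6 p z) \<bullet> u = \<alpha> u)"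
    using J6_J6[OF assms(1,2)] assms(3) tangent_closed(5)[OF J6_tangent]
    by (simp add: J6_def cross7_simps)
next
  fix v assume v: "v \<in> tangent p \<and> (\<forall>u\<in>tangent p. J6 p v \<bullet> u = \<alpha> u)"
  then have "J6 p v = z" by (intro tangent_eqI[OF J6_tangent assms(2)]) (auto simp: assms(3))
  then show "v = - J6 p z" using J6_J6[OF assms(1), of v] v by simp
qed

text \<open>After covectors become vectors, the block J^* acts as -J because J is skew-adjoint. The
  inverse of \<omega> is also -J, so the upper right block of the \<omega>-structure is +J.\<close>

lemma gvec_rep_spherical:
  assumes p: "p \<in> S6" and e: "gvec_rep p e x z"
  shows "gvec_rep p (spherical a b c p e) (a p *\<^sub>R J6 p x - b p *\<^sub>R z + c p *\<^sub>R J6 p z)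
    (- a p *\<^sub>R J6 p z + b p *\<^sub>R x + c p *\<^sub>R J6 p x)"
proof -
  have x: "fst e = x" "x \<in> tangent p" and z: "z \<in> tangent p" "\<And>u. u \<in> tangent p \<Longrightarrow> snd e u = z \<bullet> u"
    using e by (auto simp: gvec_rep_def)
  have "gvec_rep p (gJ_J p e) (J6 p x) (- J6 p z)"
    using x z inner_cross7_swap[of z p]
    by (auto simp: gvec_rep_def gJ_J_def J6_tangent tangent_closed) (simp add: J6_def)
  moreover have "gvec_rep p (gJ_form round_g p e) (- z) x"
    using x z form_inv_round_g[OF z]
    by (auto simp: gvec_rep_def gJ_form_def tangent_closed round_g_def)
  moreover have "gvec_rep p (gJ_form omega6 p e) (J6 p z) (J6 p x)"
    using x z form_inv_omega6[OF p z]
    by (auto simp: gvec_rep_def gJ_form_def tangent_closed J6_tangent omega6_def round_g_def)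
  ultimately have "gvec_rep p (spherical a b c p e)
      (a p *\<^sub>R J6 p x + b p *\<^sub>R (- z) + c p *\<^sub>R J6 p z) (a p *\<^sub>R (- J6 p z) + b p *\<^sub>R x + c p *\<^sub>R J6 p x)"
    unfolding spherical_def by (intro gvec_rep_gadd gvec_rep_gscale)
  then show ?thesis by simp
qed

section \<open>Bracket and Nijenhuis tensor in terms of vector fields\<close>

text \<open>By \<open>levi_civita_eq\<close> this is \<nabla> Y at \<open>p\<close> in the direction
  \<open>x\<close>; the direction enters only through its value at \<open>p\<close>.\<close>

definition cov_deriv :: "R7 \<Rightarrow> R7 \<Rightarrow> (R7 \<Rightarrow> R7) \<Rightarrow> R7" where
  "cov_deriv p x Y = tproj p (sphere_deriv Y p x)"

lemma smooth_vf_cong: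
  assumes X: "smooth_vf X" and eq: "\<And>x. x \<in> S6 \<Longrightarrow> X x = Y x"
  shows "smooth_vf Y"
  unfolding smooth_vf_def
proof (intro conjI ballI)
  show "smooth_map Y" by (rule smooth_map_cong[OF smooth_vfD(1)[OF X] eq])
  show "Y p \<in> tangent p" if "p \<in> S6" for p
    using smooth_vfD(2)[OF X that] eq[OF that] by simp
qed

text \<open>Vanishing torsion turns the Lie bracket into a difference of covariant derivatives. A
  metric connection commutes with the identification by g, so the dual connection becomes \<nabla>
  on the representing fields.\<close>

lemma gvec_rep_conn_bracket:
  assumes D: "levi_civita D"
    and X: "smooth_vf X" and Z: "smooth_vf Z" and Y: "smooth_vf Y" and W: "smooth_vf W"
    and v: "\<And>q. q \<in> S6 \<Longrightarrow> gvec_rep q (v q) (X q) (Z q)"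
    and w: "\<And>q. q \<in> S6 \<Longrightarrow> gvec_rep q (w q) (Y q) (W q)"
    and p: "p \<in> S6"
  shows "gvec_rep p (conn_bracket D v w p)
    (cov_deriv p (X p) Y - cov_deriv p (Y p) X) (cov_deriv p (X p) W - cov_deriv p (Y p) Z)"
proof -
  have bracket: "lie_bracket (\<lambda>q. fst (v q)) (\<lambda>q. fst (w q)) p
      = cov_deriv p (X p) Y - cov_deriv p (Y p) X"
  proof -
    have fX: "X q = fst (v q)" and fY: "Y q = fst (w q)" if "q \<in> S6" for q
      using v[OF that] w[OF that] by (auto simp: gvec_rep_def)
    have sX: "smooth_vf (\<lambda>q. fst (v q))" and sY: "smooth_vf (\<lambda>q. fst (w q))"
      using smooth_vf_cong[OF X fX] smooth_vf_cong[OF Y fY] by auto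
    have tX: "X p \<in> tangent p" and tY: "Y p \<in> tangent p"
      using X Y p by (auto intro: smooth_vfD(2))
    have "sphere_deriv (\<lambda>q. fst (w q)) p (X p) = sphere_deriv Y p (X p)"
      by (rule sphere_deriv_cong[OF fY[symmetric] p tX])
    moreover have "sphere_deriv (\<lambda>q. fst (v q)) p (Y p) = sphere_deriv X p (Y p)"
      by (rule sphere_deriv_cong[OF fX[symmetric] p tY])
    ultimately have "lie_bracket (\<lambda>q. fst (v q)) (\<lambda>q. fst (w q)) p
      = sphere_deriv Y p (X p) - sphere_deriv X p (Y p)"
      using lie_bracket_eq[OF sX sY p] fX[OF p] fY[OF p] by simp
    then show ?thesis
      using inner_sphere_deriv_vf[OF Y p tX] inner_sphere_deriv_vf[OF X p tY]
      by (simp add: cov_deriv_def tproj_def inner_commute)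
  qed
  \<comment> \<open>The fields are generalized anew because the formula is used twice, with the
    roles of the two sections exchanged.\<close>
  have dual: "dual_conn D (\<lambda>q. fst (v q)) (\<lambda>q. snd (w q)) p u = cov_deriv p (X p) W \<bullet> u"
    if X: "smooth_vf X" and W: "smooth_vf W"
      and v: "\<And>q. q \<in> S6 \<Longrightarrow> gvec_rep q (v q) (X q) (Z q)"
      and w: "\<And>q. q \<in> S6 \<Longrightarrow> gvec_rep q (w q) (Y q) (W q)" and u: "u \<in> tangent p"
    for X Z Y W u and v w :: "R7 \<Rightarrow> gvec"
  proof -
    have fX: "X q = fst (v q)" if "q \<in> S6" for q
      using v[OF that] by (auto simp: gvec_rep_def)
    have sX: "smooth_vf (\<lambda>q. fst (v q))"
      using smooth_vf_cong[OF X fX] .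
    have tX: "X p \<in> tangent p" using X p by (auto intro: smooth_vfD(2))
    have sw: "snd (w q) y = W q \<bullet> y" if "q \<in> S6" "y \<in> tangent q" for q y
      using w[OF that(1)] that(2) by (auto simp: gvec_rep_def)
    have eq: "vf_apply (\<lambda>q. fst (v q)) (\<lambda>q. snd (w q) (U q)) p - snd (w p) (D (\<lambda>q. fst (v q)) U p)
        = cov_deriv p (X p) W \<bullet> U p" if U: "smooth_vf U" for U
    proof -
      have tU: "U q \<in> tangent q" if "q \<in> S6" for q using U that by (rule smooth_vfD(2))
      have "vf_apply (\<lambda>q. fst (v q)) (\<lambda>q. snd (w q) (U q)) p = sphere_deriv (\<lambda>q. snd (w q) (U q)) p (X p)"
        by (simp add: vf_apply_def dderiv_eq fX[OF p])
      also have "\<dots> = sphere_deriv (\<lambda>q. W q \<bullet> U q) p (X p)"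
        by (rule sphere_deriv_cong[OF sw[OF _ tU] p tX])
      also have "\<dots> = W p \<bullet> sphere_deriv U p (X p) + sphere_deriv W p (X p) \<bullet> U p"
        by (rule sphere_deriv_inner[OF smooth_vfD(1)[OF W] smooth_vfD(1)[OF U] p tX])
      finally have 1: "vf_apply (\<lambda>q. fst (v q)) (\<lambda>q. snd (w q) (U q)) p
        = W p \<bullet> sphere_deriv U p (X p) + sphere_deriv W p (X p) \<bullet> U p" .
      have "D (\<lambda>q. fst (v q)) U p = tproj p (sphere_deriv U p (X p))"
        using levi_civita_eq[OF D sX U p] fX[OF p] by simp
      then have "snd (w p) (D (\<lambda>q. fst (v q)) U p) = W p \<bullet> sphere_deriv U p (X p)"
        using sw[OF p tproj_tangent[OF p]] inner_tproj[OF smooth_vfD(2)[OF W p]] by simp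
      then show ?thesis
        using 1 inner_tproj[OF tU[OF p], of "sphere_deriv W p (X p)"]
        by (simp add: cov_deriv_def inner_commute)
    qed
    show ?thesis
      unfolding dual_conn_def
    proof (rule the_equality, intro allI impI)
      fix U assume "smooth_vf U \<and> U p = u"
      then show "cov_deriv p (X p) W \<bullet> u =
          vf_apply (\<lambda>q. fst (v q)) (\<lambda>q. snd (w q) (U q)) p - snd (w p) (D (\<lambda>q. fst (v q)) U p)"
        using eq[of U] by simp
    next
      fix r assume "\<forall>U. smooth_vf U \<and> U p = u \<longrightarrow>
         r = vf_apply (\<lambda>q. fst (v q)) (\<lambda>q. snd (w q) (U q)) p - snd (w p) (D (\<lambda>q. fst (v q)) U p)"
      \<comment> \<open>The projected field is a smooth field with value \<open>u\<close> at
        \<open>p\<close>; testing on it pins down \<open>r\<close>.\<close>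
      from this[rule_format, of "\<lambda>q. tproj q u"] eq[OF smooth_vf_tproj, of u]
      show "r = cov_deriv p (X p) W \<bullet> u"
        using smooth_vf_tproj[of u] by (simp add: tproj_eq[OF u])
    qed
  qed
  show ?thesis
    unfolding gvec_rep_def conn_bracket_def Let_def
    using bracket dual[OF X W v w] dual[OF Y Z w v]
    by (auto simp: cov_deriv_def inner_diff_left intro!: tangent_closed tproj_tangent[OF p])
qed

text \<open>The pairs (X1, Z1) and (Y1, W1) represent the images of \<open>v\<close> and
  \<open>w\<close> under the structure. The pairs (e1, f1) and (e2, f2) represent the two mixed
  brackets, to which the structure is applied once more.\<close>

lemma gvec_rep_nijenhuis:
  assumes D: "levi_civita D"
    and X: "smooth_vf X" and Z: "smooth_vf Z" and Y: "smooth_vf Y" and W: "smooth_vf W"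
    and X1: "smooth_vf X1" and Z1: "smooth_vf Z1" and Y1: "smooth_vf Y1" and W1: "smooth_vf W1"
    and v: "\<And>q. q \<in> S6 \<Longrightarrow> gvec_rep q (v q) (X q) (Z q)"
    and w: "\<And>q. q \<in> S6 \<Longrightarrow> gvec_rep q (w q) (Y q) (W q)"
    and v1: "\<And>q. q \<in> S6 \<Longrightarrow> gvec_rep q (spherical a b c q (v q)) (X1 q) (Z1 q)"
    and w1: "\<And>q. q \<in> S6 \<Longrightarrow> gvec_rep q (spherical a b c q (w q)) (Y1 q) (W1 q)"
    and p: "p \<in> S6"
  defines "e1 \<equiv> cov_deriv p (X1 p) Y - cov_deriv p (Y p) X1"
    and "f1 \<equiv> cov_deriv p (X1 p) W - cov_deriv p (Y p) Z1"
    and "e2 \<equiv> cov_deriv p (X p) Y1 - cov_deriv p (Y1 p) X"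
    and "f2 \<equiv> cov_deriv p (X p) W1 - cov_deriv p (Y1 p) Z"
  shows "gvec_rep p (nijenhuis D (spherical a b c) v w p)
    (cov_deriv p (X1 p) Y1 - cov_deriv p (Y1 p) X1
      - (a p *\<^sub>R J6 p e1 - b p *\<^sub>R f1 + c p *\<^sub>R J6 p f1)
      - (a p *\<^sub>R J6 p e2 - b p *\<^sub>R f2 + c p *\<^sub>R J6 p f2)
      - (cov_deriv p (X p) Y - cov_deriv p (Y p) X))
    (cov_deriv p (X1 p) W1 - cov_deriv p (Y1 p) Z1
      - (- a p *\<^sub>R J6 p f1 + b p *\<^sub>R e1 + c p *\<^sub>R J6 p e1)
      - (- a p *\<^sub>R J6 p f2 + b p *\<^sub>R e2 + c p *\<^sub>R J6 p e2)
      - (cov_deriv p (X p) W - cov_deriv p (Y p) Z))"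
  unfolding nijenhuis_def Let_def e1_def e2_def f1_def f2_def
  by (intro gvec_rep_gdiff gvec_rep_spherical[OF p] gvec_rep_conn_bracket[OF D])
    (rule assms | assumption)+

lemma smooth_section_rep:
  assumes "smooth_vf X" "smooth_vf Z"
  shows "smooth_section (\<lambda>q. (X q, \<lambda>u. Z q \<bullet> u))"
  using assms
  by (auto simp: smooth_section_def smooth_form_def inner_add_right smooth_vf_def
      intro!: smooth_map_inner)

lemma gvec_rep_section:
  assumes "smooth_vf X" "smooth_vf Z" "q \<in> S6"
  shows "gvec_rep q (X q, \<lambda>u. Z q \<bullet> u) (X q) (Z q)"
  using assms by (simp add: gvec_rep_def smooth_vfD(2))

lemma smooth_map_cross7: "smooth_map f \<Longrightarrow> smooth_map g \<Longrightarrow> smooth_map (\<lambda>q. cross7 (f q) (g q))"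
  by (rule bounded_bilinear.smooth_map[OF bounded_bilinear_cross7])

lemma J6_tproj: "J6 q (tproj q u) = cross7 q u"
  by (simp add: J6_def tproj_def cross7_simps cross7_self)

lemma tproj_linear: "tproj p (x + y) = tproj p x + tproj p y" "tproj p (s *\<^sub>R x) = s *\<^sub>R tproj p x"
  "tproj p 0 = 0"
  by (simp_all add: tproj_def algebra_simps)

section \<open>Evaluating the Nijenhuis tensor\<close>

text \<open>
  This is \<open>f U + g JU\<close> for the projected field \<open>U q = tproj q u\<close>: \<open>J6 q (tproj q u) = cross7 q u\<close>
  since \<open>q \<times> q = 0\<close>.
\<close>
definition frame_vf :: "(R7 \<Rightarrow> real) \<Rightarrow> (R7 \<Rightarrow> real) \<Rightarrow> R7 \<Rightarrow> R7 \<Rightarrow> R7" where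
  "frame_vf f g u q = f q *\<^sub>R tproj q u + g q *\<^sub>R cross7 q u"

lemma smooth_map_cross7_const: "smooth_map (\<lambda>q. cross7 q u)"
  by (intro smooth_map_cross7 smooth_map_ident smooth_map_const)

lemma smooth_vf_frame_vf:
  assumes "smooth_fun f" "smooth_fun g"
  shows "smooth_vf (frame_vf f g u)"
  unfolding smooth_vf_def
proof (intro conjI ballI)
  show "smooth_map (frame_vf f g u)"
    unfolding frame_vf_def
    by (intro smooth_map_add smooth_map_scaleR assms smooth_vfD(1)[OF smooth_vf_tproj] smooth_map_cross7_const)
  show "frame_vf f g u p \<in> tangent p" if "p \<in> S6" for p
    using J6_tangent[of p u] tproj_tangent[OF that, of u]
    by (simp add: frame_vf_def tangent_closed J6_def)
qed

lemma smooth_vf_zero: "smooth_vf (\<lambda>q. 0)"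
  by (simp add: smooth_vf_def smooth_map_const tangent_closed)

lemma cov_deriv_zero [simp]: "cov_deriv p x (\<lambda>q. 0) = 0" "cov_deriv p 0 Y = 0"
  by (simp_all add: cov_deriv_def sphere_deriv_def tproj_linear)

text \<open>The ambient derivative of u - (q \<bullet> u) q at \<open>p\<close> is -(p \<bullet> u)
  x - (x \<bullet> u) p. The first term vanishes since \<open>u\<close> is tangent, and the second
  is normal. Hence projected fields are parallel at \<open>p\<close>.\<close>

lemma cov_deriv_tproj:
  assumes p: "p \<in> S6" and x: "x \<in> tangent p" and u: "u \<in> tangent p"
  shows "cov_deriv p x (\<lambda>q. tproj q u) = 0"
proof -
  have "sphere_deriv (\<lambda>q. q \<bullet> u) p x = x \<bullet> u"
    using sphere_deriv_inner[OF smooth_map_ident smooth_map_const p x, of u]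
    by (simp add: sphere_deriv_const sphere_deriv_ident[OF p x])
  moreover have "sphere_deriv (\<lambda>q. tproj q u) p x
      = 0 - ((p \<bullet> u) *\<^sub>R x + sphere_deriv (\<lambda>q. q \<bullet> u) p x *\<^sub>R p)"
    unfolding tproj_def
    using sphere_deriv_diff[OF smooth_map_const
        smooth_map_scaleR[OF smooth_map_inner[OF smooth_map_ident smooth_map_const] smooth_map_ident] p x, of u u]
      sphere_deriv_scaleR[OF smooth_map_inner[OF smooth_map_ident smooth_map_const] smooth_map_ident p x, of u]
    by (simp add: sphere_deriv_const sphere_deriv_ident[OF p x])
  ultimately show ?thesis
    using p u by (simp add: cov_deriv_def tproj_def tangent_def dot_square_norm)
qed

text \<open>The last term is g times (\<nabla>_x J)u: the derivative of q \<times> u along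
  \<open>x\<close> is x \<times> u, while the projected field itself is parallel at
  \<open>p\<close>.\<close>

lemma cov_deriv_frame_vf:
  assumes f: "smooth_fun f" and g: "smooth_fun g"
    and p: "p \<in> S6" and x: "x \<in> tangent p" and u: "u \<in> tangent p"
  shows "cov_deriv p x (frame_vf f g u)
    = sphere_deriv f p x *\<^sub>R u + sphere_deriv g p x *\<^sub>R cross7 p u + g p *\<^sub>R tproj p (cross7 x u)"
proof -
  have c: "sphere_deriv (\<lambda>q. cross7 q u) p x = cross7 x u"
    using bounded_bilinear.sphere_deriv[OF bounded_bilinear_cross7 smooth_map_ident smooth_map_const p x, of u]
    by (simp add: sphere_deriv_const sphere_deriv_ident[OF p x] cross7_simps)
  note sZ = smooth_vfD(1)[OF smooth_vf_tproj[of u]] and sC = smooth_map_cross7_const[of u]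
  have t: "tproj p u = u" "tproj p (cross7 p u) = cross7 p u"
    using tproj_eq u J6_tangent[of p u] by (auto simp: J6_def)
  have "sphere_deriv (frame_vf f g u) p x
      = f p *\<^sub>R sphere_deriv (\<lambda>q. tproj q u) p x + sphere_deriv f p x *\<^sub>R tproj p u
        + (g p *\<^sub>R cross7 x u + sphere_deriv g p x *\<^sub>R cross7 p u)"
    unfolding frame_vf_def
    using sphere_deriv_add[OF smooth_map_scaleR[OF f sZ] smooth_map_scaleR[OF g sC] p x]
      sphere_deriv_scaleR[OF f sZ p x] sphere_deriv_scaleR[OF g sC p x]
    by (simp add: c)
  then show ?thesis
    using cov_deriv_tproj[OF p x u] by (simp add: cov_deriv_def tproj_linear t)
qed

section \<open>Frames adapted to J\<close>

text \<open>By dimension count: \<open>u\<close> is taken orthogonal to \<open>p\<close>, then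
  \<open>w\<close> orthogonal to p, u and Ju, which span at most three of the seven
  dimensions.\<close>

lemma exists_cross7_frame:
  assumes p: "p \<in> S6"
  obtains u w where "u \<in> tangent p" "w \<in> tangent p" "u \<noteq> 0" "w \<noteq> 0" "u \<bullet> w = 0" "cross7 p u \<bullet> w = 0"
proof -
  have "dim {p} \<le> card {p}" by (rule dim_le_card') simp
  then obtain u where u: "u \<noteq> 0" "\<And>y. y \<in> span {p} \<Longrightarrow> orthogonal u y"
    using orthogonal_to_subspace_exists[of "{p}"] by auto
  have "dim {p, u, cross7 p u} \<le> card {p, u, cross7 p u}" by (rule dim_le_card') simp
  also have "\<dots> \<le> 3" by (simp add: card_insert_if)
  finally have "dim {p, u, cross7 p u} < DIM(R7)" by simp
  then obtain w where w: "w \<noteq> 0" "\<And>y. y \<in> span {p, u, cross7 p u} \<Longrightarrow> orthogonal w y"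
    using orthogonal_to_subspace_exists by blast
  have "orthogonal u p" "orthogonal w p" "orthogonal w u" "orthogonal w (cross7 p u)"
    using u w by (auto intro: span_base)
  then show ?thesis
    using that[of u w] u(1) w(1) by (simp add: tangent_def orthogonal_def inner_commute)
qed

context
  fixes p u w m n :: R7
  assumes p: "p \<in> S6" and u: "u \<in> tangent p" and w: "w \<in> tangent p"
    and uw: "u \<bullet> w = 0" and Juw: "cross7 p u \<bullet> w = 0"
  defines "m \<equiv> cross7 u w" and "n \<equiv> cross7 p (cross7 u w)"
begin

text \<open>Tangency of \<open>m\<close> comes from \<open>Juw\<close>, since p \<bullet> (u
  \<times> w) = (p \<times> u) \<bullet> w. The norm and the relations to Ju and Jw come from
  \<open>inner_cross7_cross7\<close>.\<close>

lemma frame_inner_m: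
  "m \<bullet> u = 0" "m \<bullet> w = 0" "m \<bullet> cross7 p u = 0" "m \<bullet> cross7 p w = 0" "p \<bullet> m = 0"
  "m \<bullet> m = (u \<bullet> u) * (w \<bullet> w)"
proof -
  have pu: "p \<bullet> u = 0" "p \<bullet> w = 0" using u w by (auto simp: tangent_def)
  show "m \<bullet> u = 0" "m \<bullet> w = 0"
    using inner_cross7_left[of u w] inner_cross7_right[of w u] by (auto simp: m_def inner_commute)
  show "m \<bullet> cross7 p u = 0"
    using inner_cross7_cross7[of u w p] pu uw
    by (simp add: m_def cross7_anticommute[of p u] inner_commute)
  have "m = - cross7 w u" by (simp add: m_def cross7_anticommute[of u w])
  then show "m \<bullet> cross7 p w = 0"
    using inner_cross7_cross7[of w u p] pu uw
    by (simp add: cross7_anticommute[of p w] inner_commute)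
  show "p \<bullet> m = 0"
    using inner_cross7_swap[of p u w] Juw by (simp add: m_def cross7_anticommute[of p u])
  show "m \<bullet> m = (u \<bullet> u) * (w \<bullet> w)"
    using inner_cross7_cross7[of u w w] uw by (simp add: m_def)
qed

text \<open>With n = Jm, the relations for \<open>m\<close> carry over because J is skew-adjoint and
  isometric on tangent vectors.\<close>

lemma frame_inner_n:
  "n \<bullet> u = 0" "n \<bullet> w = 0" "n \<bullet> cross7 p u = 0" "n \<bullet> cross7 p w = 0" "n \<bullet> m = 0"
  "n \<bullet> n = (u \<bullet> u) * (w \<bullet> w)"
proof -
  have n: "n = cross7 p m" by (simp add: n_def m_def)
  have pp: "p \<bullet> p = 1" using p by (simp add: dot_square_norm)
  have pu: "p \<bullet> u = 0" "p \<bullet> w = 0" using u w by (auto simp: tangent_def)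
  show "n \<bullet> u = 0" "n \<bullet> w = 0"
    using inner_cross7_swap[of u p m] inner_cross7_swap[of w p m] frame_inner_m
    by (auto simp: n inner_commute)
  show "n \<bullet> cross7 p u = 0" "n \<bullet> cross7 p w = 0" "n \<bullet> n = (u \<bullet> u) * (w \<bullet> w)"
    using frame_inner_m pu pp by (auto simp: n inner_cross7_cross7)
  show "n \<bullet> m = 0"
    using inner_cross7_right[of m p] by (simp add: n inner_commute)
qed

text \<open>As p, u and w are orthogonal, \<open>cross7_alternative\<close> reduces to (Ju) \<times>
  w = -J(u \<times> w), and likewise with \<open>u\<close> and \<open>w\<close> exchanged.\<close>

lemma frame_cross7:
  "cross7 w u = - m" "cross7 (cross7 p u) w = - n" "cross7 (cross7 p w) u = n"
proof -
  have pu: "p \<bullet> u = 0" "p \<bullet> w = 0" using u w by (auto simp: tangent_def)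
  show wu: "cross7 w u = - m" by (simp add: m_def cross7_anticommute[of u w])
  show "cross7 (cross7 p u) w = - n"
    using cross7_alternative[of p u w] pu uw by (simp add: n_def eq_neg_iff_add_eq_0)
  show "cross7 (cross7 p w) u = n"
    using cross7_alternative[of p w u] pu uw
    by (simp add: wu n_def m_def cross7_simps inner_commute)
qed

lemma frame_tangent: "m \<in> tangent p" "n \<in> tangent p"
  using frame_inner_m J6_tangent[of p "cross7 u w"] by (auto simp: tangent_def n_def J6_def)

lemma inner_tproj_m: "m \<bullet> tproj p x = m \<bullet> x" and inner_tproj_n: "n \<bullet> tproj p x = n \<bullet> x"
  by (rule inner_tproj[OF frame_tangent(1)], rule inner_tproj[OF frame_tangent(2)])

end

section \<open>Consequences of integrability at a point\<close>

text \<open>For the sections (0, U) and (0, W) the plain bracket is zero, having no vector part. The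
  mixed brackets vanish because U and W are parallel at \<open>p\<close>, so integrability says that
  the bracket of the two images is zero.\<close>

lemma integrable_covector_directions:
  assumes D: "levi_civita D"
    and a: "smooth_fun a" and b: "smooth_fun b" and c: "smooth_fun c"
    and int: "conn_integrable D (spherical a b c)" and p: "p \<in> S6"
  shows "c p = 0" "a p * b p = 0"
proof -
  obtain u w where frame: "u \<in> tangent p" "w \<in> tangent p" "u \<bullet> w = 0" "cross7 p u \<bullet> w = 0"
    and ne: "u \<noteq> 0" "w \<noteq> 0"
    using exists_cross7_frame[OF p] by metis
  define m n where "m = cross7 u w" and "n = cross7 p m"
  note frame_facts = frame_inner_m[OF p frame, folded m_def, folded n_def]
    frame_inner_n[OF p frame, folded m_def, folded n_def] frame_cross7[OF p frame, folded m_def, folded n_def]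
    m_def[symmetric] n_def[symmetric]
    inner_tproj_m[OF p frame, folded m_def, folded n_def] inner_tproj_n[OF p frame, folded m_def, folded n_def]
  let ?v = "\<lambda>u q. (0 :: R7, \<lambda>y. tproj q u \<bullet> y)"
  \<comment> \<open>These are the components -bU + cJU and -aJU of the image of (0, U).\<close>
  let ?X = "\<lambda>u. frame_vf (\<lambda>q. - b q) c u" and ?Z = "\<lambda>u. frame_vf (\<lambda>q. 0) (\<lambda>q. - a q) u"
  have sX: "smooth_vf (?X u)" and sZ: "smooth_vf (?Z u)" for u
    by (intro smooth_vf_frame_vf smooth_map_minus smooth_map_const a b c)+
  have rep: "gvec_rep q (?v u q) 0 (tproj q u)" if "q \<in> S6" for q u
    using gvec_rep_section[OF smooth_vf_zero smooth_vf_tproj that] .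
  have rep1: "gvec_rep q (spherical a b c q (?v u q)) (?X u q) (?Z u q)" if "q \<in> S6" for q u
    using gvec_rep_spherical[OF that rep[OF that], of a b c u]
    by (simp add: J6_tproj frame_vf_def) (simp add: J6_def cross7_simps)
  have sec: "smooth_section (?v u)" for u
    by (rule smooth_section_rep[OF smooth_vf_zero smooth_vf_tproj])
  have val: "?X u p = - b p *\<^sub>R u + c p *\<^sub>R cross7 p u" if "u \<in> tangent p" for u
    by (simp add: frame_vf_def tproj_eq[OF that])
  have tX: "?X u p \<in> tangent p" for u using smooth_vfD(2)[OF sX p] .
  have "eq_at p (nijenhuis D (spherical a b c) (?v u) (?v w) p) gzero"
    using int sec p unfolding conn_integrable_def by blast
  note zero = gvec_rep_eq_gzero[OF gvec_rep_nijenhuis[OF D smooth_vf_zero smooth_vf_tproj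
        smooth_vf_zero smooth_vf_tproj sX sZ sX sZ rep rep rep1 rep1 p] this]
  have covZ: "cov_deriv p (?X u p) (\<lambda>q. tproj q w) = 0" "cov_deriv p (?X w p) (\<lambda>q. tproj q u) = 0"
    by (rule cov_deriv_tproj[OF p tX]; fact)+
  have E1: "cov_deriv p (?X u p) (?X w) - cov_deriv p (?X w p) (?X u) = 0"
    using zero(1) by (simp add: covZ J6_def cross7_simps)
  have E2: "cov_deriv p (?X u p) (?Z w) - cov_deriv p (?X w p) (?Z u) = 0"
    using zero(2) by (simp add: covZ J6_def cross7_simps)
  have k: "(u \<bullet> u) * (w \<bullet> w) \<noteq> 0" using ne by simp
  \<comment> \<open>Only the J-parts survive: (Ju) \<times> w = -n and (Jw) \<times> u = n enter
    with one \<open>c\<close> from the direction and one from the coefficient of J.\<close>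
  have "n \<bullet> (cov_deriv p (?X u p) (?X w) - cov_deriv p (?X w p) (?X u))
      = - 2 * (c p)\<^sup>2 * ((u \<bullet> u) * (w \<bullet> w))"
    unfolding cov_deriv_frame_vf[OF smooth_map_minus[OF b] c p tX frame(1)]
      cov_deriv_frame_vf[OF smooth_map_minus[OF b] c p tX frame(2)]
    unfolding val[OF frame(1)] val[OF frame(2)]
    by (simp add: inner_add_right inner_diff_right frame_facts cross7_simps power2_eq_square)
  then show c0: "c p = 0" using E1 k by simp
  \<comment> \<open>Here u \<times> w = m and w \<times> u = -m enter with -b from the direction and
    -a from the coefficient of J.\<close>
  have "m \<bullet> (cov_deriv p (?X u p) (?Z w) - cov_deriv p (?X w p) (?Z u))
      = 2 * (a p * b p) * ((u \<bullet> u) * (w \<bullet> w))"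
    unfolding cov_deriv_frame_vf[OF smooth_map_const smooth_map_minus[OF a] p tX frame(1)]
      cov_deriv_frame_vf[OF smooth_map_const smooth_map_minus[OF a] p tX frame(2)]
    unfolding val[OF frame(1)] val[OF frame(2)]
    by (simp add: c0 inner_add_right inner_diff_right frame_facts cross7_simps)
  then show "a p * b p = 0" using E2 k by simp
qed

text \<open>With b = c = 0 on the whole sphere the image of (U, 0) is (aJU, 0) near \<open>p\<close>
  as well, so only derivatives of \<open>a\<close> occur. What remains is the Nijenhuis tensor of
  aJ, which detects that J is not integrable.\<close>

lemma integrable_tangent_directions:
  assumes D: "levi_civita D" and a: "smooth_fun a"
    and bc: "\<And>q. q \<in> S6 \<Longrightarrow> b q = 0 \<and> c q = 0"
    and int: "conn_integrable D (spherical a b c)" and p: "p \<in> S6"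
  shows "a p = 0"
proof -
  obtain u w where frame: "u \<in> tangent p" "w \<in> tangent p" "u \<bullet> w = 0" "cross7 p u \<bullet> w = 0"
    and ne: "u \<noteq> 0" "w \<noteq> 0"
    using exists_cross7_frame[OF p] by metis
  define m n where "m = cross7 u w" and "n = cross7 p m"
  note frame_facts = frame_inner_m[OF p frame, folded m_def, folded n_def]
    frame_inner_n[OF p frame, folded m_def, folded n_def] frame_cross7[OF p frame, folded m_def, folded n_def]
    m_def[symmetric] n_def[symmetric]
    inner_tproj_m[OF p frame, folded m_def, folded n_def] inner_tproj_n[OF p frame, folded m_def, folded n_def]
  \<comment> \<open>The covector is written \<open>0 \<bullet> y\<close> to match
    \<open>gvec_rep_section\<close> with the zero field.\<close>
  let ?v = "\<lambda>u q. (tproj q u, \<lambda>y. 0 \<bullet> y)"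
  let ?X = "\<lambda>u. frame_vf (\<lambda>q. 0) a u"
  have sX: "smooth_vf (?X u)" for u
    by (intro smooth_vf_frame_vf smooth_map_const a)
  have rep: "gvec_rep q (?v u q) (tproj q u) 0" if "q \<in> S6" for q u
    using gvec_rep_section[OF smooth_vf_tproj smooth_vf_zero that] .
  have rep1: "gvec_rep q (spherical a b c q (?v u q)) (?X u q) 0" if "q \<in> S6" for q u
    using gvec_rep_spherical[OF that rep[OF that], of a b c u] bc[OF that]
    by (simp add: J6_tproj frame_vf_def) (simp add: J6_def cross7_simps)
  have sec: "smooth_section (?v u)" for u
    by (rule smooth_section_rep[OF smooth_vf_tproj smooth_vf_zero])
  have val: "?X u p = a p *\<^sub>R cross7 p u" for u
    by (simp add: frame_vf_def)
  have tX: "?X u p \<in> tangent p" for u using smooth_vfD(2)[OF sX p] .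
  have bc0: "b p = 0" "c p = 0" using bc[OF p] by auto
  have "eq_at p (nijenhuis D (spherical a b c) (?v u) (?v w) p) gzero"
    using int sec p unfolding conn_integrable_def by blast
  note zero = gvec_rep_eq_gzero(1)[OF gvec_rep_nijenhuis[OF D smooth_vf_tproj smooth_vf_zero
        smooth_vf_tproj smooth_vf_zero sX smooth_vf_zero sX smooth_vf_zero rep rep rep1 rep1 p] this]
  have cov0: "cov_deriv p x (\<lambda>q. tproj q w) = 0" "cov_deriv p x (\<lambda>q. tproj q u) = 0"
    if "x \<in> tangent p" for x
    by (rule cov_deriv_tproj[OF p that]; fact)+
  have "cov_deriv p (?X u p) (?X w) - cov_deriv p (?X w p) (?X u)
      + a p *\<^sub>R J6 p (cov_deriv p w (?X u)) - a p *\<^sub>R J6 p (cov_deriv p u (?X w)) = 0"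
    using zero by (simp add: cov0[OF tX] cov0[OF frame(1)] cov0[OF frame(2)] bc0
        tproj_eq[OF frame(1)] tproj_eq[OF frame(2)] J6_def cross7_simps)
  \<comment> \<open>Each of the four terms contributes -a^2 |u|^2 |w|^2; the derivatives of
    \<open>a\<close> come with Ju, Jw or, after applying J, with u, w, all orthogonal to
    \<open>n\<close>.\<close>
  moreover have "n \<bullet> (cov_deriv p (?X u p) (?X w) - cov_deriv p (?X w p) (?X u)
      + a p *\<^sub>R J6 p (cov_deriv p w (?X u)) - a p *\<^sub>R J6 p (cov_deriv p u (?X w)))
      = - 4 * (a p)\<^sup>2 * ((u \<bullet> u) * (w \<bullet> w))"
  proof -
    have pp: "p \<bullet> p = 1" using p by (simp add: dot_square_norm)
    have pu: "p \<bullet> u = 0" "p \<bullet> w = 0" using frame by (auto simp: tangent_def)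
    have tm: "tproj p m = m" "tproj p (- m) = - m"
      using tproj_eq frame_tangent(1)[OF p frame, folded m_def] tangent_closed(5) by blast+
    show ?thesis
      unfolding cov_deriv_frame_vf[OF smooth_map_const a p tX frame(1)]
        cov_deriv_frame_vf[OF smooth_map_const a p tX frame(2)]
        cov_deriv_frame_vf[OF smooth_map_const a p frame(2) frame(1)]
        cov_deriv_frame_vf[OF smooth_map_const a p frame(1) frame(2)]
      unfolding val
      by (simp add: sphere_deriv_const frame_facts tm cross7_simps J6_def cross7_cross7 pp pu
          inner_add_right inner_diff_right power2_eq_square)
  qed
  ultimately show ?thesis using ne by simp
qed

section \<open>Passing from points to the whole sphere\<close>

lemma smooth_map_continuous_on: "smooth_map f \<Longrightarrow> continuous_on S6 f"
  unfolding continuous_on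
proof
  fix p :: R7 assume f: "smooth_map f" and p: "p \<in> S6"
  obtain U F where F: "open U" "p \<in> U" "\<And>k. Ck_on k F U" "\<And>x. x \<in> U \<inter> S6 \<Longrightarrow> F x = f x"
    using smooth_map_extension[OF f p] by metis
  have "isCont F p"
    using F(1,2) F(3)[of 0] continuous_on_eq_continuous_at by auto
  then have "(F \<longlongrightarrow> F p) (at p within S6)"
    using continuous_at_imp_continuous_at_within continuous_within by blast
  moreover have "openin (top_of_set S6) (S6 \<inter> U)"
    using F(1) by (rule openin_open_Int)
  ultimately have "(f \<longlongrightarrow> F p) (at p within S6)"
    by (rule Lim_transform_within_openin) (use F p in auto)
  then show "(f \<longlongrightarrow> f p) (at p within S6)" using F(2) F(4)[of p] p by simp
qed

theorem proposition3p0p2: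
  fixes nabla_LC :: connection7
  assumes "levi_civita nabla_LC"
  shows "\<not> (\<exists>a b c :: R7 \<Rightarrow> real.
           smooth_fun a \<and> smooth_fun b \<and> smooth_fun c \<and>
           (\<forall>p\<in>S6. (a p)\<^sup>2 + (b p)\<^sup>2 + (c p)\<^sup>2 = 1) \<and>
           \<not> (\<forall>p\<in>S6. b p = 1) \<and> \<not> (\<forall>p\<in>S6. b p = - 1) \<and>
           conn_integrable nabla_LC (spherical a b c))"
proof (intro notI, elim exE conjE)
  fix a b c :: "R7 \<Rightarrow> real"
  assume a: "smooth_fun a" and b: "smooth_fun b" and c: "smooth_fun c"
    and sum1: "\<forall>p\<in>S6. (a p)\<^sup>2 + (b p)\<^sup>2 + (c p)\<^sup>2 = 1"
    and b1: "\<not> (\<forall>p\<in>S6. b p = 1)" "\<not> (\<forall>p\<in>S6. b p = - 1)"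
    and int: "conn_integrable nabla_LC (spherical a b c)"
  have c0: "c p = 0" and ab: "a p * b p = 0" if "p \<in> S6" for p
    using integrable_covector_directions[OF assms a b c int that] by auto
  have ab1: "(a p)\<^sup>2 + (b p)\<^sup>2 = 1" if "p \<in> S6" for p
    using bspec[OF sum1 that] c0[OF that] by simp
  \<comment> \<open>Either b = 0, or a = 0 and then b^2 = 1.\<close>
  have "b p \<in> {0, 1, -1}" if "p \<in> S6" for p
    using ab[OF that] ab1[OF that] by (auto simp: power2_eq_1_iff)
  then have "b ` S6 \<subseteq> {0, 1, -1}" by blast
  then have "finite (b ` S6)" by (rule finite_subset) simp
  moreover have "connected S6" by (rule connected_sphere) simp
  ultimately have "b constant_on S6"
    using continuous_finite_range_constant smooth_map_continuous_on[OF b] by blast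
  then obtain k where k: "\<And>p. p \<in> S6 \<Longrightarrow> b p = k"
    unfolding constant_on_def by blast
  have e: "axis 0 1 \<in> S6" by simp
  \<comment> \<open>The assumptions only exclude the constant functions 1 and -1, so they become
    usable once \<open>b\<close> is known to be constant.\<close>
  have "k \<noteq> 1" "k \<noteq> - 1" using b1 k by auto
  then have "k = 0" using ab[OF e] ab1[OF e] k[OF e] by (auto simp: power2_eq_1_iff)
  then have bc: "b q = 0 \<and> c q = 0" if "q \<in> S6" for q
    using k c0 that by blast
  have "a (axis 0 1) = 0"
    by (rule integrable_tangent_directions[OF assms a bc int e])
  then show False using ab1[OF e] bc[OF e] by simp
qed

end
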